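(* $\omega=\omega'\circ(\varphi\restriction\mathscr{C})$ as natural transformations $\sigma\restriction\mathscr{C}\Rightarrow\iota$; that is, for every pointed coarse space $(X,\xi)$ in $\mathscr{C}$ one has $\omega_{(X,\xi)}=\omega'_{(X,\xi)}\circ\varphi_{(X,\xi)}$ as maps $\sigma(X,\xi)\to\iota(X,\xi)$.
   Context: A coarse structure on a set $X$ is an ideal $\mathcal{C}_X$ of the poset $(\mathcal{P}(X\times X),\subseteq)$ containing the diagonal and closed under composition $E\circ F=\{(x,y)\mid \exists z\in X,\ (x,z)\in E,\ (z,y)\in F\}$ and inversion; its elements are called controlled sets. A coarse space is a set with a coarse structure. $B\subseteq X$ is bounded if $B\times B\in\mathcal{C}_X$. A map between coarse spaces is proper if preimages of bounded sets are bounded, bornologous if $(f\times f)(E)$ is controlled for each controlled $E$, and coarse if proper and bornologous. $\mathbf{Coarse}_*$ is the category of pointed coarse spaces and basepoint-preserving coarse maps. A coarse sequence in $(X,\xi)$ is a coarse map $s\colon(\mathbb{N},0)\to(X,\xi)$, where $\mathbb{N}$ has the coarse structure consisting of sets on which $|i-j|$ is bounded. $S(X,\xi)$ is the set of coarse sequences in $(X,\xi)$. $\sigma$: for $s,t\in S(X,\xi)$, $s\equiv^{\sigma}_{X,\xi}t$ if there is a finite sequence $s=s_0,\dots,s_n=t$ in $S(X,\xi)$ such that for each $i<n$ one of $s_i,s_{i+1}$ is a subsequence of the other. Put $\sigma(X,\xi):=S(X,\xi)/{\equiv^{\sigma}_{X,\xi}}$ and $\sigma f[s]:=[f\circ s]$.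 $\varepsilon$: for $E\in\mathcal{C}_X$, a set $A\subseteq X$ is $E$-connected if any $x,y\in A$ are joined by a finite sequence $x=x_0,\dots,x_n=y$ in $A$ with $(x_i,x_{i+1})\in E$ for all $i<n$ (an $E$-chain). For $s,t\in S(X,\xi)$, $s\equiv^{\varepsilon}_{X,\xi}t$ if there is $E\in\mathcal{C}_X$ such that for every bounded $B\subseteq X$ with $\xi\in B$ there is $N\in\mathbb{N}$ such that $\{s(i)\}_{i\ge N}$ and $\{t(i)\}_{i\ge N}$ are contained in the same $E$-connected component of $X\setminus B$. Put $\varepsilon(X,\xi):=S(X,\xi)/{\equiv^{\varepsilon}_{X,\xi}}$ and $\varepsilon f[s]:=[f\circ s]$. Nonstandard setting: $\mathscr{C}$ is a fixed small full subcategory of $\mathbf{Coarse}_*$; $\mathbb{U}$ (the standard universe) is a transitive set containing $\mathscr{C}$ and all classical objects needed, with respect to which the needed set-theoretic formulae are absolute; ${}^{*}\colon\mathbb{U}\hookrightarrow{}^{*}\mathbb{U}$, $x\mapsto{}^{*}x$, is a fixed sufficiently saturated elementary extension (families of internal sets indexed by a set in $\mathbb{U}$ and having the finite intersection property have nonempty intersection). Points $x$ of a standard space are identified with ${}^{*}x$. "Standard" means belonging to $\mathbb{U}$. $\iota$: for a standard coarse space $X$ and $x,y\in{}^{*}X$, $x\sim_X y$ iff $(x,y)\in{}^{*}E$ for some (standard) $E\in\mathcal{C}_X$. $\operatorname{INF}(X,\xi):=\{x\in{}^{*}X\mid x\not\sim_X\xi\}$. For $x,y\in\operatorname{INF}(X,\xi)$,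 $x\equiv^{\iota}_{X,\xi}y$ if there is an internal hyperfinite sequence $\{x_i\}_{i\le n}$ ($n\in{}^{*}\mathbb{N}$) in $\operatorname{INF}(X,\xi)$ with $x_0=x$, $x_n=y$ and $x_i\sim_X x_{i+1}$ for all $i<n$. Put $\iota(X,\xi):=\operatorname{INF}(X,\xi)/{\equiv^{\iota}_{X,\xi}}$ and $\iota f[x]:=[{}^{*}f(x)]$ for morphisms $f$ of $\mathscr{C}$. The natural transformations are given, for $s\in S(X,\xi)$ and any $i\in{}^{*}\mathbb{N}\setminus\mathbb{N}$, by $\varphi_{(X,\xi)}\colon\sigma(X,\xi)\to\varepsilon(X,\xi)$, $[s]_{\equiv^{\sigma}_{X,\xi}}\mapsto[s]_{\equiv^{\varepsilon}_{X,\xi}}$ (for all pointed coarse spaces); $\omega_{(X,\xi)}\colon\sigma(X,\xi)\to\iota(X,\xi)$, $[s]_{\equiv^{\sigma}_{X,\xi}}\mapsto[{}^{*}s(i)]_{\equiv^{\iota}_{X,\xi}}$ (for $(X,\xi)$ in $\mathscr{C}$); $\omega'_{(X,\xi)}\colon\varepsilon(X,\xi)\to\iota(X,\xi)$, $[s]_{\equiv^{\varepsilon}_{X,\xi}}\mapsto[{}^{*}s(i)]_{\equiv^{\iota}_{X,\xi}}$ (for $(X,\xi)$ in $\mathscr{C}$). All three are well-defined and natural, and the values of $\omega$ and $\omega'$ do not depend on $i$. *)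

theory Defs
  imports "HOL-Library.FuncSet"
begin

section \<open>Coarse spaces\<close>

record 'a pointed_space =
  pts :: "'a set"
  ctrl :: "('a \<times> 'a) set set"
  base :: 'a

definition coarse_structure :: "'a set \<Rightarrow> ('a \<times> 'a) set set \<Rightarrow> bool" where
  "coarse_structure X C \<longleftrightarrow>
     C \<subseteq> Pow (X \<times> X) \<and>
     (\<forall>E\<in>C. \<forall>F\<subseteq>E. F \<in> C) \<and> (\<forall>E\<in>C. \<forall>F\<in>C. E \<union> F \<in> C) \<and>
     Id_on X \<in> C \<and> (\<forall>E\<in>C. \<forall>F\<in>C. E O F \<in> C) \<and> (\<forall>E\<in>C. E\<inverse> \<in> C)"

definition pointed_coarse_space :: "'a pointed_space \<Rightarrow> bool" where
  "pointed_coarse_space P \<longleftrightarrow> coarse_structure (pts P) (ctrl P) \<and> base P \<in> pts P"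

definition bounded_in :: "'a pointed_space \<Rightarrow> 'a set \<Rightarrow> bool" where
  "bounded_in P B \<longleftrightarrow> B \<subseteq> pts P \<and> B \<times> B \<in> ctrl P"

definition proper_map :: "'a pointed_space \<Rightarrow> 'b pointed_space \<Rightarrow> ('a \<Rightarrow> 'b) \<Rightarrow> bool" where
  "proper_map P Q f \<longleftrightarrow> (\<forall>B. bounded_in Q B \<longrightarrow> bounded_in P {x \<in> pts P. f x \<in> B})"

definition bornologous :: "'a pointed_space \<Rightarrow> 'b pointed_space \<Rightarrow> ('a \<Rightarrow> 'b) \<Rightarrow> bool" where
  "bornologous P Q f \<longleftrightarrow> (\<forall>E\<in>ctrl P. map_prod f f ` E \<in> ctrl Q)"

definition pointed_coarse_map :: "'a pointed_space \<Rightarrow> 'b pointed_space \<Rightarrow> ('a \<Rightarrow> 'b) \<Rightarrow> bool" where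
  "pointed_coarse_map P Q f \<longleftrightarrow>
     f \<in> pts P \<rightarrow> pts Q \<and> proper_map P Q f \<and> bornologous P Q f \<and> f (base P) = base Q"

definition nat_space :: "nat pointed_space" where
  "nat_space = \<lparr>pts = UNIV,
                ctrl = {E. \<exists>k. \<forall>(i, j)\<in>E. \<bar>int i - int j\<bar> \<le> k},
                base = 0\<rparr>"

definition coarse_seqs :: "'a pointed_space \<Rightarrow> (nat \<Rightarrow> 'a) set" where
  "coarse_seqs P = {s. pointed_coarse_map nat_space P s}"


section \<open>The invariants sigma and epsilon\<close>

definition subsequence :: "(nat \<Rightarrow> 'a) \<Rightarrow> (nat \<Rightarrow> 'a) \<Rightarrow> bool" where
  "subsequence t s \<longleftrightarrow> (\<exists>k. strict_mono k \<and> t = s \<circ> k)"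

definition sigma_rel :: "'a pointed_space \<Rightarrow> ((nat \<Rightarrow> 'a) \<times> (nat \<Rightarrow> 'a)) set" where
  "sigma_rel P = {(s, t). \<exists>(n::nat) u. u 0 = s \<and> u n = t \<and> (\<forall>i\<le>n. u i \<in> coarse_seqs P) \<and>
     (\<forall>i<n. subsequence (u i) (u (Suc i)) \<or> subsequence (u (Suc i)) (u i))}"

definition sigma :: "'a pointed_space \<Rightarrow> (nat \<Rightarrow> 'a) set set" where
  "sigma P = coarse_seqs P // sigma_rel P"

definition chain_connected :: "('a \<times> 'a) set \<Rightarrow> 'a set \<Rightarrow> bool" where
  "chain_connected E A \<longleftrightarrow> (\<forall>x\<in>A. \<forall>y\<in>A. \<exists>(n::nat) u. u 0 = x \<and> u n = y \<and>
     (\<forall>i\<le>n. u i \<in> A) \<and> (\<forall>i<n. (u i, u (Suc i)) \<in> E))"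

definition chain_component :: "('a \<times> 'a) set \<Rightarrow> 'a set \<Rightarrow> 'a set \<Rightarrow> bool" where
  "chain_component E Y A \<longleftrightarrow> A \<subseteq> Y \<and> chain_connected E A \<and>
     (\<forall>A'. A \<subseteq> A' \<and> A' \<subseteq> Y \<and> chain_connected E A' \<longrightarrow> A' = A)"

definition epsilon_rel :: "'a pointed_space \<Rightarrow> ((nat \<Rightarrow> 'a) \<times> (nat \<Rightarrow> 'a)) set" where
  "epsilon_rel P = {(s, t). s \<in> coarse_seqs P \<and> t \<in> coarse_seqs P \<and>
     (\<exists>E\<in>ctrl P. \<forall>B. bounded_in P B \<and> base P \<in> B \<longrightarrow>
        (\<exists>N A. chain_component E (pts P - B) A \<and> s ` {N..} \<subseteq> A \<and> t ` {N..} \<subseteq> A))}"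

definition epsilon :: "'a pointed_space \<Rightarrow> (nat \<Rightarrow> 'a) set set" where
  "epsilon P = coarse_seqs P // epsilon_rel P"

text \<open>
  Maps out of a quotient are defined by definite description over all representatives; this
  yields the intended map precisely because the value does not depend on the representative.
\<close>

definition phi :: "'a pointed_space \<Rightarrow> (nat \<Rightarrow> 'a) set \<Rightarrow> (nat \<Rightarrow> 'a) set" where
  "phi P = (\<lambda>c\<in>sigma P. THE q. \<exists>s\<in>c. q = epsilon_rel P `` {s})"


section \<open>Set theory inside a membership structure\<close>

text \<open>
  A universe is a type together with a binary relation \<open>m\<close>, where \<open>m x a\<close> reads "\<open>x\<close> is an
  element of \<open>a\<close>".  The formulas below are the first-order formulas of the language of set
  theory, with variables named by natural numbers.
\<close>

datatype fm = FMem nat nat | FEq nat nat | FNeg fm | FConj fm fm | FEx nat fm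

primrec sat :: "('v \<Rightarrow> 'v \<Rightarrow> bool) \<Rightarrow> fm \<Rightarrow> (nat \<Rightarrow> 'v) \<Rightarrow> bool" where
  "sat m (FMem i j) v \<longleftrightarrow> m (v i) (v j)"
| "sat m (FEq i j) v \<longleftrightarrow> v i = v j"
| "sat m (FNeg p) v \<longleftrightarrow> \<not> sat m p v"
| "sat m (FConj p q) v \<longleftrightarrow> sat m p v \<and> sat m q v"
| "sat m (FEx i p) v \<longleftrightarrow> (\<exists>a. sat m p (v(i := a)))"

definition elts :: "('v \<Rightarrow> 'v \<Rightarrow> bool) \<Rightarrow> 'v \<Rightarrow> 'v set" where
  "elts m a = {x. m x a}"

definition coded :: "('v \<Rightarrow> 'v \<Rightarrow> bool) \<Rightarrow> 'v set \<Rightarrow> bool" where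
  "coded m A \<longleftrightarrow> (\<exists>a. elts m a = A)"

text \<open>Meaningful only if \<open>coded m A\<close>; the code is then unique by extensionality.\<close>

definition code :: "('v \<Rightarrow> 'v \<Rightarrow> bool) \<Rightarrow> 'v set \<Rightarrow> 'v" where
  "code m A = (THE a. elts m a = A)"

text \<open>Kuratowski pairs, and relations and functions as sets of such pairs.\<close>

definition opair :: "('v \<Rightarrow> 'v \<Rightarrow> bool) \<Rightarrow> 'v \<Rightarrow> 'v \<Rightarrow> 'v" where
  "opair m x y = code m {code m {x}, code m {x, y}}"

definition rel_of :: "('v \<Rightarrow> 'v \<Rightarrow> bool) \<Rightarrow> 'v \<Rightarrow> ('v \<times> 'v) set" where
  "rel_of m r = {(x, y). m (opair m x y) r}"

definition pair_set :: "('v \<Rightarrow> 'v \<Rightarrow> bool) \<Rightarrow> ('v \<times> 'v) set \<Rightarrow> 'v set" where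
  "pair_set m R = (\<lambda>(x, y). opair m x y) ` R"

definition graph_on :: "'a set \<Rightarrow> ('a \<Rightarrow> 'b) \<Rightarrow> ('a \<times> 'b) set" where
  "graph_on D f = (\<lambda>x. (x, f x)) ` D"

definition app :: "('v \<Rightarrow> 'v \<Rightarrow> bool) \<Rightarrow> 'v \<Rightarrow> 'v \<Rightarrow> 'v" where
  "app m f x = (THE y. (x, y) \<in> rel_of m f)"

text \<open>Von Neumann numerals: the successor of \<open>a\<close> is \<open>a \<union> {a}\<close>, and \<open>i < j\<close> is membership.\<close>

definition succ :: "('v \<Rightarrow> 'v \<Rightarrow> bool) \<Rightarrow> 'v \<Rightarrow> 'v" where
  "succ m a = code m (insert a (elts m a))"

primrec num :: "('v \<Rightarrow> 'v \<Rightarrow> bool) \<Rightarrow> nat \<Rightarrow> 'v" where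
  "num m 0 = code m {}"
| "num m (Suc n) = succ m (num m n)"

definition seq_set :: "('v \<Rightarrow> 'v \<Rightarrow> bool) \<Rightarrow> (nat \<Rightarrow> 'v) \<Rightarrow> 'v set" where
  "seq_set m s = pair_set m (range (\<lambda>n. (num m n, s n)))"

text \<open>The set coding the controlled sets, and the code of the triple \<open>(X, (C, \<xi>))\<close>.\<close>

definition ctrl_set :: "('v \<Rightarrow> 'v \<Rightarrow> bool) \<Rightarrow> 'v pointed_space \<Rightarrow> 'v set" where
  "ctrl_set m P = (\<lambda>E. code m (pair_set m E)) ` ctrl P"

definition space_code :: "('v \<Rightarrow> 'v \<Rightarrow> bool) \<Rightarrow> 'v pointed_space \<Rightarrow> 'v" where
  "space_code m P = opair m (code m (pts P)) (opair m (code m (ctrl_set m P)) (base P))"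


section \<open>The nonstandard setting\<close>

text \<open>
  By Mostowski collapse, the transitive sets are, up to isomorphism, the well-founded
  extensional structures \<open>('u, mem)\<close>; so the type \<open>'u\<close> plays the role of the standard universe.
  Its separation schema and its closure under finite sets provide the absoluteness that is
  needed; no closure under power sets is required.  The small full subcategory is given by its
  set of objects \<open>CC\<close>, whose points are elements of the universe by transitivity.  The
  universe contains the set of objects, the spaces with their controlled sets, the morphisms,
  the natural numbers, and the coarse sequences.
\<close>

locale standard_universe =
  fixes mem :: "'u \<Rightarrow> 'u \<Rightarrow> bool"
    and CC :: "'u pointed_space set"
  assumes extensional: "\<And>a b. elts mem a = elts mem b \<Longrightarrow> a = b"
    and well_founded: "wf {(x, a). mem x a}"
    and finite_sets: "\<And>A. finite A \<Longrightarrow> coded mem A"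
    and separation: "\<And>p v i a. coded mem {x \<in> elts mem a. sat mem p (v(i := x))}"
    and naturals: "coded mem (range (num mem))"
    and spaces: "\<And>P. P \<in> CC \<Longrightarrow> pointed_coarse_space P"
    and points_coded: "\<And>P. P \<in> CC \<Longrightarrow> coded mem (pts P)"
    and controlled_coded: "\<And>P E. P \<in> CC \<Longrightarrow> E \<in> ctrl P \<Longrightarrow> coded mem (pair_set mem E)"
    and structure_coded: "\<And>P. P \<in> CC \<Longrightarrow> coded mem (ctrl_set mem P)"
    and objects_coded: "coded mem (space_code mem ` CC)"
    and morphisms_coded: "\<And>P Q f. P \<in> CC \<Longrightarrow> Q \<in> CC \<Longrightarrow> pointed_coarse_map P Q f \<Longrightarrow>
          coded mem (pair_set mem (graph_on (pts P) f))"
    and sequences_coded: "\<And>P s. P \<in> CC \<Longrightarrow> s \<in> coarse_seqs P \<Longrightarrow> coded mem (seq_set mem s)"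

text \<open>
  The extension is an arbitrary structure \<open>('s, smem)\<close>, in general neither well-founded nor an
  ultrapower.  Internal sets are its elements, identified with their extensions
  \<open>elts smem\<close>; the index function \<open>F\<close> in the saturation property is arbitrary (external).
\<close>

locale nonstandard_setting = standard_universe mem CC
  for mem :: "'u \<Rightarrow> 'u \<Rightarrow> bool" and CC :: "'u pointed_space set" +
  fixes smem :: "'s \<Rightarrow> 's \<Rightarrow> bool"
    and star :: "'u \<Rightarrow> 's"
  assumes elementary: "\<And>p v. sat smem p (\<lambda>i. star (v i)) \<longleftrightarrow> sat mem p v"
    and saturated: "\<And>a F. (\<And>J. finite J \<Longrightarrow> J \<subseteq> elts mem a \<Longrightarrow> (\<Inter>j\<in>J. elts smem (F j)) \<noteq> {}) \<Longrightarrow>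
          (\<Inter>j\<in>elts mem a. elts smem (F j)) \<noteq> {}"


section \<open>The invariant iota and the comparison maps\<close>

definition star_set ::
  "('u \<Rightarrow> 'u \<Rightarrow> bool) \<Rightarrow> ('s \<Rightarrow> 's \<Rightarrow> bool) \<Rightarrow> ('u \<Rightarrow> 's) \<Rightarrow> 'u set \<Rightarrow> 's set" where
  "star_set mem smem star A = elts smem (star (code mem A))"

definition star_rel ::
  "('u \<Rightarrow> 'u \<Rightarrow> bool) \<Rightarrow> ('s \<Rightarrow> 's \<Rightarrow> bool) \<Rightarrow> ('u \<Rightarrow> 's) \<Rightarrow> ('u \<times> 'u) set \<Rightarrow> ('s \<times> 's) set" where
  "star_rel mem smem star E = rel_of smem (star (code mem (pair_set mem E)))"

definition star_seq ::
  "('u \<Rightarrow> 'u \<Rightarrow> bool) \<Rightarrow> ('s \<Rightarrow> 's \<Rightarrow> bool) \<Rightarrow> ('u \<Rightarrow> 's) \<Rightarrow> (nat \<Rightarrow> 'u) \<Rightarrow> 's \<Rightarrow> 's" where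
  "star_seq mem smem star s i = app smem (star (code mem (seq_set mem s))) i"

definition hypernats ::
  "('u \<Rightarrow> 'u \<Rightarrow> bool) \<Rightarrow> ('s \<Rightarrow> 's \<Rightarrow> bool) \<Rightarrow> ('u \<Rightarrow> 's) \<Rightarrow> 's set" where
  "hypernats mem smem star = star_set mem smem star (range (num mem))"

definition infinite_hypernats ::
  "('u \<Rightarrow> 'u \<Rightarrow> bool) \<Rightarrow> ('s \<Rightarrow> 's \<Rightarrow> bool) \<Rightarrow> ('u \<Rightarrow> 's) \<Rightarrow> 's set" where
  "infinite_hypernats mem smem star = hypernats mem smem star - range (\<lambda>n. star (num mem n))"

definition finitely_close ::
  "('u \<Rightarrow> 'u \<Rightarrow> bool) \<Rightarrow> ('s \<Rightarrow> 's \<Rightarrow> bool) \<Rightarrow> ('u \<Rightarrow> 's) \<Rightarrow> 'u pointed_space \<Rightarrow> 's \<Rightarrow> 's \<Rightarrow> bool" where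
  "finitely_close mem smem star P x y \<longleftrightarrow> (\<exists>E\<in>ctrl P. (x, y) \<in> star_rel mem smem star E)"

definition INF_pts ::
  "('u \<Rightarrow> 'u \<Rightarrow> bool) \<Rightarrow> ('s \<Rightarrow> 's \<Rightarrow> bool) \<Rightarrow> ('u \<Rightarrow> 's) \<Rightarrow> 'u pointed_space \<Rightarrow> 's set" where
  "INF_pts mem smem star P =
     {x \<in> star_set mem smem star (pts P). \<not> finitely_close mem smem star P x (star (base P))}"

text \<open>
  For a hypernatural \<open>n\<close>, the set \<open>{i. i < n}\<close> is \<open>elts smem n\<close>.  The sequence
  \<open>u\<close>, defined on \<open>{i. i \<le> n}\<close>, is internal if its graph is an internal set.
\<close>

definition iota_rel ::
  "('u \<Rightarrow> 'u \<Rightarrow> bool) \<Rightarrow> ('s \<Rightarrow> 's \<Rightarrow> bool) \<Rightarrow> ('u \<Rightarrow> 's) \<Rightarrow> 'u pointed_space \<Rightarrow> ('s \<times> 's) set" where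
  "iota_rel mem smem star P = {(x, y). \<exists>n\<in>hypernats mem smem star. \<exists>u.
     coded smem (pair_set smem (graph_on (insert n (elts smem n)) u)) \<and>
     (\<forall>i\<in>insert n (elts smem n). u i \<in> INF_pts mem smem star P) \<and>
     u (star (num mem 0)) = x \<and> u n = y \<and>
     (\<forall>i\<in>elts smem n. finitely_close mem smem star P (u i) (u (succ smem i)))}"

definition iota ::
  "('u \<Rightarrow> 'u \<Rightarrow> bool) \<Rightarrow> ('s \<Rightarrow> 's \<Rightarrow> bool) \<Rightarrow> ('u \<Rightarrow> 's) \<Rightarrow> 'u pointed_space \<Rightarrow> 's set set" where
  "iota mem smem star P = INF_pts mem smem star P // iota_rel mem smem star P"

definition omega ::
  "('u \<Rightarrow> 'u \<Rightarrow> bool) \<Rightarrow> ('s \<Rightarrow> 's \<Rightarrow> bool) \<Rightarrow> ('u \<Rightarrow> 's) \<Rightarrow> 'u pointed_space \<Rightarrow>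
     (nat \<Rightarrow> 'u) set \<Rightarrow> 's set" where
  "omega mem smem star P = (\<lambda>c\<in>sigma P. THE q. \<exists>s\<in>c. \<exists>i\<in>infinite_hypernats mem smem star.
        q = iota_rel mem smem star P `` {star_seq mem smem star s i})"

definition omega' ::
  "('u \<Rightarrow> 'u \<Rightarrow> bool) \<Rightarrow> ('s \<Rightarrow> 's \<Rightarrow> bool) \<Rightarrow> ('u \<Rightarrow> 's) \<Rightarrow> 'u pointed_space \<Rightarrow>
     (nat \<Rightarrow> 'u) set \<Rightarrow> 's set" where
  "omega' mem smem star P = (\<lambda>c\<in>epsilon P. THE q. \<exists>s\<in>c. \<exists>i\<in>infinite_hypernats mem smem star.
        q = iota_rel mem smem star P `` {star_seq mem smem star s i})"

end

theory Submission
  imports Defs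
begin

text \<open>
  All three comparison maps send a class to the class of one representative, so everything rests
  on the well-definedness of \<open>omega'\<close>: if \<open>s\<close> and \<open>t\<close> are epsilon-equivalent and \<open>i\<close>, \<open>j\<close> are
  infinite, then \<open>*s(i)\<close> and \<open>*t(j)\<close> are joined by an internal chain of infinite points.  By
  saturation there is an internal controlled set \<open>D\<close> above all \<open>*E\<close> with \<open>E\<close> standard.
  Transferring the statement that chains avoiding any given bounded set exist, with \<open>D\<close> in the role
  of the bounded set, yields a single internal chain, so no set of all finite chains is needed.
\<close>

section \<open>Coarse sequences\<close>

text \<open>Being infinite and being finitely close are external notions: no formula can mention
  them, and a chain of infinite length is out of reach of external induction. The transferred
  statements therefore control chains by internal data alone, namely a relation containing all steps
  and a condition on the values. In the epsilon relation the controlled set for the steps is chosen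
  before the bounded set. After transfer it stays standard, so steps are finitely close, while the
  bounded set may be one that swallows every standard neighbourhood of the base point. The map
  \<open>omega\<close> is treated together with \<open>omega'\<close>, because every sigma class
  lies inside an epsilon class.\<close>

lemma nat_space_ctrl_Suc: "(\<lambda>k. (k, Suc k)) ` UNIV \<in> ctrl nat_space"
  "(\<lambda>k. (Suc k, k)) ` UNIV \<in> ctrl nat_space"
  by (auto simp: nat_space_def intro!: exI[of _ 1])

text \<open>A bornologous map carries the controlled set of pairs of neighbouring naturals to a
  controlled set; so a coarse sequence is itself a chain, in both directions.\<close>

lemma coarse_seq_steps_controlled:
  assumes "s \<in> coarse_seqs P"
  shows "range (\<lambda>k. (s k, s (Suc k))) \<in> ctrl P" "range (\<lambda>k. (s (Suc k), s k)) \<in> ctrl P"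
proof -
  have "bornologous nat_space P s"
    using assms by (simp add: coarse_seqs_def pointed_coarse_map_def)
  then have "map_prod s s ` E \<in> ctrl P" if "E \<in> ctrl nat_space" for E
    using that by (auto simp: bornologous_def)
  from this[OF nat_space_ctrl_Suc(1)] this[OF nat_space_ctrl_Suc(2)]
  show "range (\<lambda>k. (s k, s (Suc k))) \<in> ctrl P" "range (\<lambda>k. (s (Suc k), s k)) \<in> ctrl P"
    by (simp_all add: image_image)
qed

lemma coarse_seq_in_pts: "s \<in> coarse_seqs P \<Longrightarrow> s k \<in> pts P"
  by (auto simp: coarse_seqs_def pointed_coarse_map_def nat_space_def)

lemma bounded_nat_spaceD:
  assumes "bounded_in nat_space B"
  obtains N where "\<And>k. k \<in> B \<Longrightarrow> k < N"
proof (cases "B = {}")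
  case False
  then obtain b where b: "b \<in> B" by auto
  obtain c where "\<forall>(i, j)\<in>B \<times> B. \<bar>int i - int j\<bar> \<le> c"
    using assms by (auto simp: bounded_in_def nat_space_def)
  then have "\<bar>int k - int b\<bar> \<le> c" if "k \<in> B" for k
    using b that by auto
  then have "k < Suc (b + nat c)" if "k \<in> B" for k
    using that by fastforce
  then show thesis by (rule that)
qed (use that in auto)

text \<open>This is properness: the preimage of \<open>B\<close> is a bounded set of naturals, hence
  lies below some \<open>N\<close>.\<close>

lemma coarse_seq_eventually_outside:
  assumes "s \<in> coarse_seqs P" "bounded_in P B"
  obtains N where "\<And>k. N \<le> k \<Longrightarrow> s k \<notin> B"
proof -
  have "bounded_in nat_space {k \<in> pts nat_space. s k \<in> B}"
    using assms by (auto simp: coarse_seqs_def pointed_coarse_map_def proper_map_def)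
  then obtain N where "\<And>k. k \<in> {k \<in> pts nat_space. s k \<in> B} \<Longrightarrow> k < N"
    by (rule bounded_nat_spaceD) blast
  then have "s k \<notin> B" if "N \<le> k" for k
    using that by (fastforce simp: nat_space_def)
  then show thesis by (rule that)
qed

section \<open>Closure properties of coarse structures and neighbourhoods of the base point\<close>

lemma pointed_coarse_spaceD:
  assumes "pointed_coarse_space P"
  shows "E \<in> ctrl P \<Longrightarrow> E \<subseteq> pts P \<times> pts P"
    "E \<in> ctrl P \<Longrightarrow> F \<subseteq> E \<Longrightarrow> F \<in> ctrl P"
    "E \<in> ctrl P \<Longrightarrow> F \<in> ctrl P \<Longrightarrow> E \<union> F \<in> ctrl P"
    "Id_on (pts P) \<in> ctrl P"
    "E \<in> ctrl P \<Longrightarrow> F \<in> ctrl P \<Longrightarrow> E O F \<in> ctrl P"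
    "E \<in> ctrl P \<Longrightarrow> E\<inverse> \<in> ctrl P"
    "base P \<in> pts P"
proof -
  have C: "ctrl P \<subseteq> Pow (pts P \<times> pts P)" "\<forall>E\<in>ctrl P. \<forall>F\<subseteq>E. F \<in> ctrl P"
    "\<forall>E\<in>ctrl P. \<forall>F\<in>ctrl P. E \<union> F \<in> ctrl P" "\<forall>E\<in>ctrl P. \<forall>F\<in>ctrl P. E O F \<in> ctrl P"
    "\<forall>E\<in>ctrl P. E\<inverse> \<in> ctrl P"
    using assms by (simp_all add: pointed_coarse_space_def coarse_structure_def)
  show "E \<in> ctrl P \<Longrightarrow> E \<subseteq> pts P \<times> pts P" using C(1) by auto
  show "E \<in> ctrl P \<Longrightarrow> F \<subseteq> E \<Longrightarrow> F \<in> ctrl P" using C(2) by simp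
  show "E \<in> ctrl P \<Longrightarrow> F \<in> ctrl P \<Longrightarrow> E \<union> F \<in> ctrl P" using C(3) by simp
  show "E \<in> ctrl P \<Longrightarrow> F \<in> ctrl P \<Longrightarrow> E O F \<in> ctrl P" using C(4) by simp
  show "E \<in> ctrl P \<Longrightarrow> E\<inverse> \<in> ctrl P" using C(5) by simp
qed (use assms in \<open>simp_all add: pointed_coarse_space_def coarse_structure_def\<close>)

text \<open>Supplies the finite intersection property in \<open>controlled_upper_bound\<close>. The
  empty union is controlled as a subset of the diagonal.\<close>

lemma controlled_Union:
  assumes "pointed_coarse_space P" "finite \<E>" "\<E> \<subseteq> ctrl P"
  shows "\<Union>\<E> \<in> ctrl P"
  using assms(2,3)
proof induction
  case empty
  then show ?case
    using pointed_coarse_spaceD(2)[OF assms(1) pointed_coarse_spaceD(4)[OF assms(1)], of "{}"]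
    by simp
next
  case (insert E \<E>)
  then show ?case using pointed_coarse_spaceD(3)[OF assms(1), of E "\<Union>\<E>"] by simp
qed

text \<open>Turns quantification over bounded sets into quantification over controlled sets, which
  are the members of a coded set. The base point is added because the epsilon relation only
  considers bounded sets containing it.\<close>

definition base_nbhd :: "'a pointed_space \<Rightarrow> ('a \<times> 'a) set \<Rightarrow> 'a set" where
  "base_nbhd P E = insert (base P) {x. (x, base P) \<in> E}"

lemma bounded_base_nbhd:
  assumes "pointed_coarse_space P" "E \<in> ctrl P"
  shows "bounded_in P (base_nbhd P E)"
proof -
  note D = pointed_coarse_spaceD[OF assms(1)]
  \<comment> \<open>The diagonal covers the base point itself; any two points of the neighbourhood
    are then linked through the base point.\<close>
  let ?F = "E \<union> Id_on (pts P)"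
  have "?F \<in> ctrl P" by (rule D(3)[OF assms(2) D(4)])
  then have F: "?F O ?F\<inverse> \<in> ctrl P" by (intro D(5) D(6))
  have "base_nbhd P E \<times> base_nbhd P E \<subseteq> ?F O ?F\<inverse>"
    using D(7) by (auto simp: base_nbhd_def)
  from D(2)[OF F this]
  have "base_nbhd P E \<times> base_nbhd P E \<in> ctrl P" .
  moreover have "base_nbhd P E \<subseteq> pts P"
    using D(1)[OF assms(2)] D(7) by (auto simp: base_nbhd_def)
  ultimately show ?thesis
    by (simp add: bounded_in_def)
qed

section \<open>Chain components and the comparison of sigma with epsilon\<close>

text \<open>Cutting \<open>E\<close> down to \<open>A \<times> A\<close> encodes that the chain
  stays in \<open>A\<close>, so that composition and monotonicity come from the closure operator.
  Index 0 is no target of a step, which is where \<open>x \<in> A\<close> enters.\<close>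

lemma chain_connected_iff:
  "chain_connected E A \<longleftrightarrow> (\<forall>x\<in>A. \<forall>y\<in>A. (x, y) \<in> (E \<inter> A \<times> A)\<^sup>*)"
proof -
  have "(\<exists>(n::nat) u. u 0 = x \<and> u n = y \<and> (\<forall>i\<le>n. u i \<in> A) \<and> (\<forall>i<n. (u i, u (Suc i)) \<in> E))
      \<longleftrightarrow> (x, y) \<in> (E \<inter> A \<times> A)\<^sup>*" (is "?L \<longleftrightarrow> ?R") if "x \<in> A" for x y
  proof
    assume ?L
    then obtain n :: nat and u where u: "u 0 = x" "u n = y" "\<forall>i\<le>n. u i \<in> A"
      "\<forall>i<n. (u i, u (Suc i)) \<in> E" by blast
    then have "(x, y) \<in> (E \<inter> A \<times> A) ^^ n"
      unfolding relpow_fun_conv by (intro exI[of _ u]) auto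
    then show ?R by (rule relpow_imp_rtrancl)
  next
    assume ?R
    then obtain n where "(x, y) \<in> (E \<inter> A \<times> A) ^^ n"
      using rtrancl_imp_relpow by blast
    then obtain u where u: "u 0 = x" "u n = y" "\<forall>i<n. (u i, u (Suc i)) \<in> E \<inter> A \<times> A"
      unfolding relpow_fun_conv by blast
    have "u i \<in> A" if "i \<le> n" for i
      using u that \<open>x \<in> A\<close> by (cases i) auto
    with u show ?L by (intro exI[of _ n] exI[of _ u] conjI allI impI) blast+
  qed
  then show ?thesis unfolding chain_connected_def by (intro ball_cong refl)
qed

lemma chain_connected_mono:
  assumes "chain_connected E A" "E \<subseteq> F"
  shows "chain_connected F A"
proof -
  have "(E \<inter> A \<times> A)\<^sup>* \<subseteq> (F \<inter> A \<times> A)\<^sup>*"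
    by (rule rtrancl_mono) (use assms(2) in auto)
  then show ?thesis
    using assms(1) unfolding chain_connected_iff by blast
qed

text \<open>Any two points are joined through the common point \<open>a\<close>.\<close>

lemma chain_connected_Union:
  assumes conn: "\<And>A. A \<in> \<A> \<Longrightarrow> chain_connected E A" and a: "\<And>A. A \<in> \<A> \<Longrightarrow> a \<in> A"
  shows "chain_connected E (\<Union>\<A>)"
  unfolding chain_connected_iff
proof (intro ballI)
  have *: "(x, y) \<in> (E \<inter> \<Union>\<A> \<times> \<Union>\<A>)\<^sup>*" if "x \<in> A" "y \<in> A" "A \<in> \<A>" for x y A
  proof -
    have "(x, y) \<in> (E \<inter> A \<times> A)\<^sup>*"
      using conn[OF \<open>A \<in> \<A>\<close>] that unfolding chain_connected_iff by blast
    then show ?thesis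
      by (rule rtrancl_mono[THEN subsetD, rotated]) (use that in auto)
  qed
  fix x y assume "x \<in> \<Union>\<A>" "y \<in> \<Union>\<A>"
  then obtain A B where "A \<in> \<A>" "B \<in> \<A>" "x \<in> A" "y \<in> B" by auto
  then have "(x, a) \<in> (E \<inter> \<Union>\<A> \<times> \<Union>\<A>)\<^sup>*" "(a, y) \<in> (E \<inter> \<Union>\<A> \<times> \<Union>\<A>)\<^sup>*"
    using * a by blast+
  then show "(x, y) \<in> (E \<inter> \<Union>\<A> \<times> \<Union>\<A>)\<^sup>*" by (rule rtrancl_trans)
qed

text \<open>The component is the union of all connected subsets of \<open>Y\<close> through
  \<open>a\<close>; it is connected by \<open>chain_connected_Union\<close> and hence
  maximal.\<close>

lemma chain_component_exists:
  assumes "chain_connected E A" "A \<subseteq> Y" "a \<in> A"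
  obtains A' where "chain_component E Y A'" "A \<subseteq> A'"
proof -
  let ?\<A> = "{A'. a \<in> A' \<and> A' \<subseteq> Y \<and> chain_connected E A'}"
  have "chain_connected E (\<Union>?\<A>)" by (rule chain_connected_Union) auto
  then have "chain_component E Y (\<Union>?\<A>)"
    using assms unfolding chain_component_def by blast
  moreover have "A \<subseteq> \<Union>?\<A>" using assms by blast
  ultimately show thesis by (rule that)
qed

section \<open>The epsilon relation is an equivalence relation containing the sigma relation\<close>

lemma epsilon_relD:
  "(s, t) \<in> epsilon_rel P \<Longrightarrow> \<exists>E\<in>ctrl P. \<forall>B. bounded_in P B \<and> base P \<in> B \<longrightarrow>
      (\<exists>N A. chain_component E (pts P - B) A \<and> s ` {N..} \<subseteq> A \<and> t ` {N..} \<subseteq> A)"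
  by (simp add: epsilon_rel_def)

lemma epsilon_relI:
  assumes "s \<in> coarse_seqs P" "t \<in> coarse_seqs P" "E \<in> ctrl P"
    "\<And>B. bounded_in P B \<Longrightarrow> base P \<in> B \<Longrightarrow>
      \<exists>N A. chain_component E (pts P - B) A \<and> s ` {N..} \<subseteq> A \<and> t ` {N..} \<subseteq> A"
  shows "(s, t) \<in> epsilon_rel P"
  using assms by (auto simp: epsilon_rel_def)

lemma epsilon_rel_coarse_seqs:
  "(s, t) \<in> epsilon_rel P \<Longrightarrow> s \<in> coarse_seqs P \<and> t \<in> coarse_seqs P"
  by (simp add: epsilon_rel_def)

text \<open>A tail of \<open>s\<close> outside \<open>B\<close> is connected by the steps of
  \<open>s\<close> and their reverses. This controlled set depends on \<open>s\<close> only, as the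
  order of quantifiers demands.\<close>

lemma epsilon_rel_refl:
  assumes P: "pointed_coarse_space P" and s: "s \<in> coarse_seqs P"
  shows "(s, s) \<in> epsilon_rel P"
proof -
  define E where "E = range (\<lambda>k. (s k, s (Suc k))) \<union> range (\<lambda>k. (s (Suc k), s k))"
  have E: "E \<in> ctrl P"
    unfolding E_def using coarse_seq_steps_controlled[OF s] pointed_coarse_spaceD(3)[OF P] by blast
  have "\<exists>N A. chain_component E (pts P - B) A \<and> s ` {N..} \<subseteq> A" if B: "bounded_in P B" for B
  proof -
    obtain N where N: "\<And>k. N \<le> k \<Longrightarrow> s k \<notin> B"
      by (rule coarse_seq_eventually_outside[OF s B]) blast
    let ?A = "s ` {N..}"
    let ?R = "E \<inter> ?A \<times> ?A"
    have up: "(s N, s k) \<in> ?R\<^sup>*" and down: "(s k, s N) \<in> ?R\<^sup>*" if "N \<le> k" for k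
      using that
    proof (induction k rule: dec_induct)
      case (step k)
      have "(s k, s (Suc k)) \<in> ?R" "(s (Suc k), s k) \<in> ?R"
        using step.hyps by (auto simp: E_def)
      with step.IH show "(s N, s (Suc k)) \<in> ?R\<^sup>*" "(s (Suc k), s N) \<in> ?R\<^sup>*"
        by (auto intro: rtrancl_into_rtrancl converse_rtrancl_into_rtrancl)
    qed auto
    have "chain_connected E ?A"
      unfolding chain_connected_iff using up down by (blast intro: rtrancl_trans)
    moreover have "?A \<subseteq> pts P - B" "s N \<in> ?A"
      using N coarse_seq_in_pts[OF s] by auto
    ultimately obtain A where "chain_component E (pts P - B) A" "?A \<subseteq> A"
      by (rule chain_component_exists)
    then show ?thesis by blast
  qed
  then show ?thesis by (intro epsilon_relI[OF s s E]) simp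
qed

lemma epsilon_rel_sym: "(s, t) \<in> epsilon_rel P \<Longrightarrow> (t, s) \<in> epsilon_rel P"
  unfolding epsilon_rel_def by (simp only: mem_Collect_eq case_prod_conv conj_ac)

text \<open>The two components share a late term of \<open>t\<close>, so their union is connected
  for \<open>E \<union> F\<close> and extends to one component.\<close>

lemma epsilon_rel_trans:
  assumes P: "pointed_coarse_space P" and st: "(s, t) \<in> epsilon_rel P" and tr: "(t, r) \<in> epsilon_rel P"
  shows "(s, r) \<in> epsilon_rel P"
proof -
  obtain E where E: "E \<in> ctrl P" "\<forall>B. bounded_in P B \<and> base P \<in> B \<longrightarrow>
      (\<exists>N A. chain_component E (pts P - B) A \<and> s ` {N..} \<subseteq> A \<and> t ` {N..} \<subseteq> A)"
    using epsilon_relD[OF st] ..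
  obtain F where F: "F \<in> ctrl P" "\<forall>B. bounded_in P B \<and> base P \<in> B \<longrightarrow>
      (\<exists>N A. chain_component F (pts P - B) A \<and> t ` {N..} \<subseteq> A \<and> r ` {N..} \<subseteq> A)"
    using epsilon_relD[OF tr] ..
  have "\<exists>N A. chain_component (E \<union> F) (pts P - B) A \<and> s ` {N..} \<subseteq> A \<and> r ` {N..} \<subseteq> A"
    if B: "bounded_in P B" "base P \<in> B" for B
  proof -
    obtain N A where A: "chain_component E (pts P - B) A" "s ` {N..} \<subseteq> A" "t ` {N..} \<subseteq> A"
      using E(2) B by blast
    obtain M C where C: "chain_component F (pts P - B) C" "t ` {M..} \<subseteq> C" "r ` {M..} \<subseteq> C"
      using F(2) B by blast
    let ?t = "t (max N M)"
    have tt: "?t \<in> A" "?t \<in> C" using A(3) C(2) by auto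
    have "chain_connected (E \<union> F) A" "chain_connected (E \<union> F) C"
      using A(1) C(1) chain_connected_mono[of E A "E \<union> F"] chain_connected_mono[of F C "E \<union> F"]
      by (simp_all add: chain_component_def)
    then have "chain_connected (E \<union> F) (\<Union>{A, C})"
      using tt by (intro chain_connected_Union[where a = ?t]) auto
    moreover have "\<Union>{A, C} \<subseteq> pts P - B" "?t \<in> \<Union>{A, C}"
      using A(1) C(1) tt by (auto simp: chain_component_def)
    ultimately obtain A' where A': "chain_component (E \<union> F) (pts P - B) A'" "\<Union>{A, C} \<subseteq> A'"
      by (rule chain_component_exists)
    have AC: "A \<subseteq> A'" "C \<subseteq> A'" using A'(2) by simp_all
    have "s ` {max N M..} \<subseteq> A'"
      by (rule order_trans[OF image_mono order_trans[OF A(2) AC(1)]]) simp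
    moreover have "r ` {max N M..} \<subseteq> A'"
      by (rule order_trans[OF image_mono order_trans[OF C(3) AC(2)]]) simp
    ultimately show ?thesis using A'(1) by blast
  qed
  moreover have "E \<union> F \<in> ctrl P" using E(1) F(1) pointed_coarse_spaceD(3)[OF P] by blast
  ultimately show ?thesis
    using epsilon_rel_coarse_seqs[OF st] epsilon_rel_coarse_seqs[OF tr]
    by (intro epsilon_relI[of _ _ _ "E \<union> F"]) auto
qed

lemma equiv_epsilon_rel:
  assumes "pointed_coarse_space P"
  shows "equiv (coarse_seqs P) (epsilon_rel P)"
proof (rule equivI)
  show "epsilon_rel P \<subseteq> coarse_seqs P \<times> coarse_seqs P"
    by (auto dest: epsilon_rel_coarse_seqs)
qed (auto simp: refl_on_def sym_def trans_def
      intro: epsilon_rel_refl[OF assms] epsilon_rel_sym epsilon_rel_trans[OF assms])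

text \<open>Since \<open>i \<le> k i\<close>, each tail of the subsequence lies in the tail of
  \<open>s\<close> with the same starting index, so reflexivity for \<open>s\<close> already
  provides the component.\<close>

lemma subsequence_epsilon_rel:
  assumes "pointed_coarse_space P" "s \<in> coarse_seqs P" "t \<in> coarse_seqs P" "subsequence t s"
  shows "(s, t) \<in> epsilon_rel P"
proof -
  obtain k where k: "strict_mono k" "t = s \<circ> k"
    using assms(4) unfolding subsequence_def by blast
  have "N \<le> k i" if "N \<le> i" for N i
    using order_trans[OF that strict_mono_imp_increasing[OF k(1)]] .
  then have sub: "t ` {N..} \<subseteq> s ` {N..}" for N
    using k(2) by auto
  obtain E where E: "E \<in> ctrl P" "\<forall>B. bounded_in P B \<and> base P \<in> B \<longrightarrow>
      (\<exists>N A. chain_component E (pts P - B) A \<and> s ` {N..} \<subseteq> A \<and> s ` {N..} \<subseteq> A)"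
    using epsilon_relD[OF epsilon_rel_refl[OF assms(1,2)]] ..
  show ?thesis
  proof (rule epsilon_relI[OF assms(2,3) E(1)])
    fix B assume "bounded_in P B" "base P \<in> B"
    with E(2) obtain N A where "chain_component E (pts P - B) A" "s ` {N..} \<subseteq> A"
      by blast
    with sub[of N] show "\<exists>N A. chain_component E (pts P - B) A \<and> s ` {N..} \<subseteq> A \<and> t ` {N..} \<subseteq> A"
      by (intro exI[of _ N] exI[of _ A]) simp
  qed
qed

text \<open>All links of a sigma chain are coarse sequences, so neighbouring links are compared as
  subsequences, in either direction by symmetry. This is the independence of representatives behind
  \<open>phi\<close> and \<open>omega\<close>.\<close>

lemma sigma_rel_subset_epsilon_rel:
  assumes P: "pointed_coarse_space P"
  shows "sigma_rel P \<subseteq> epsilon_rel P"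
proof (rule subrelI)
  fix s t assume "(s, t) \<in> sigma_rel P"
  then obtain n :: nat and u where u: "u 0 = s" "u n = t" "\<And>i. i \<le> n \<Longrightarrow> u i \<in> coarse_seqs P"
    "\<And>i. i < n \<Longrightarrow> subsequence (u i) (u (Suc i)) \<or> subsequence (u (Suc i)) (u i)"
    unfolding sigma_rel_def by blast
  have "(s, u i) \<in> epsilon_rel P" if "i \<le> n" for i
    using that
  proof (induction i)
    case 0
    then show ?case using u epsilon_rel_refl[OF P] by blast
  next
    case (Suc i)
    then have "(u i, u (Suc i)) \<in> epsilon_rel P"
      using u(3)[of i] u(3)[of "Suc i"] u(4)[of i] subsequence_epsilon_rel[OF P] epsilon_rel_sym
      by (metis Suc_leD Suc_le_lessD)
    with Suc show ?case using epsilon_rel_trans[OF P] by (meson Suc_leD)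
  qed
  with u(2) show "(s, t) \<in> epsilon_rel P" by blast
qed

lemma sigma_rel_refl: "s \<in> coarse_seqs P \<Longrightarrow> (s, s) \<in> sigma_rel P"
  unfolding sigma_rel_def by (intro CollectI case_prodI exI[of _ 0] exI[of _ "\<lambda>_. s"]) auto

lemma phi_class:
  assumes P: "pointed_coarse_space P" and s: "s \<in> coarse_seqs P"
  shows "phi P (sigma_rel P `` {s}) = epsilon_rel P `` {s}"
proof -
  have "(THE q. \<exists>t\<in>sigma_rel P `` {s}. q = epsilon_rel P `` {t}) = epsilon_rel P `` {s}"
  proof (rule the_equality)
    show "\<exists>t\<in>sigma_rel P `` {s}. epsilon_rel P `` {s} = epsilon_rel P `` {t}"
      using sigma_rel_refl[OF s] by blast
  next
    fix q assume "\<exists>t\<in>sigma_rel P `` {s}. q = epsilon_rel P `` {t}"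
    then show "q = epsilon_rel P `` {s}"
      using sigma_rel_subset_epsilon_rel[OF P] equiv_class_eq[OF equiv_epsilon_rel[OF P]] by blast
  qed
  then show ?thesis using s by (simp add: phi_def sigma_def quotientI)
qed

text \<open>The points \<open>s l\<close> with \<open>i \<le> l\<close> and \<open>t l\<close> with \<open>j \<le> l\<close> are admitted even inside the
  neighbourhood, so \<open>i\<close> and \<open>j\<close> need not be large relative to \<open>D\<close>: the chain first follows \<open>s\<close>
  out of the neighbourhood and finally follows \<open>t\<close> back.\<close>

lemma epsilon_rel_chain:
  assumes P: "pointed_coarse_space P" and st: "(s, t) \<in> epsilon_rel P"
  shows "\<exists>E\<in>ctrl P. \<forall>D\<in>ctrl P. \<forall>i j. \<exists>S \<subseteq> {a \<in> pts P. (\<exists>l\<ge>i. a = s l) \<or> (\<exists>l\<ge>j. a = t l) \<or>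
      (a, base P) \<notin> D}. s i \<in> S \<and> (s i, t j) \<in> (E \<inter> S \<times> S)\<^sup>*"
proof -
  have s: "s \<in> coarse_seqs P" and t: "t \<in> coarse_seqs P"
    using epsilon_rel_coarse_seqs[OF st] by auto
  obtain E where E: "E \<in> ctrl P" "\<forall>B. bounded_in P B \<and> base P \<in> B \<longrightarrow>
      (\<exists>N A. chain_component E (pts P - B) A \<and> s ` {N..} \<subseteq> A \<and> t ` {N..} \<subseteq> A)"
    using epsilon_relD[OF st] ..
  \<comment> \<open>\<open>E\<close> serves the part outside the neighbourhood; the added pairs run
    forwards along \<open>s\<close> and backwards along \<open>t\<close>. Nothing here depends on
    \<open>D\<close>, \<open>i\<close> or \<open>j\<close>.\<close>
  define F where "F = E \<union> (range (\<lambda>k. (s k, s (Suc k))) \<union> range (\<lambda>k. (t (Suc k), t k)))"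
  have "F \<in> ctrl P"
    unfolding F_def
    by (intro pointed_coarse_spaceD(3)[OF P] E(1) coarse_seq_steps_controlled[OF s]
        coarse_seq_steps_controlled[OF t])
  moreover have "\<exists>S \<subseteq> {a \<in> pts P. (\<exists>l\<ge>i. a = s l) \<or> (\<exists>l\<ge>j. a = t l) \<or> (a, base P) \<notin> D}.
      s i \<in> S \<and> (s i, t j) \<in> (F \<inter> S \<times> S)\<^sup>*" if D: "D \<in> ctrl P" for D i j
  proof (intro exI conjI subset_refl)
    let ?S = "{a \<in> pts P. (\<exists>l\<ge>i. a = s l) \<or> (\<exists>l\<ge>j. a = t l) \<or> (a, base P) \<notin> D}"
    let ?R = "(F \<inter> ?S \<times> ?S)\<^sup>*"
    have sS: "s l \<in> ?S" if "i \<le> l" for l using that coarse_seq_in_pts[OF s] by blast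
    have tS: "t l \<in> ?S" if "j \<le> l" for l using that coarse_seq_in_pts[OF t] by blast
    show "s i \<in> ?S" by (rule sS) simp
    obtain N A where A: "chain_component E (pts P - base_nbhd P D) A" "s ` {N..} \<subseteq> A" "t ` {N..} \<subseteq> A"
      using E(2) bounded_base_nbhd[OF P D] by (auto simp: base_nbhd_def)
    \<comment> \<open>At \<open>M\<close> both sequences have entered the component and both legs
      along \<open>s\<close> and \<open>t\<close> can be attached.\<close>
    define M where "M = max N (max i j)"
    have M: "N \<le> M" "i \<le> M" "j \<le> M" by (auto simp: M_def)
    have 1: "(s i, s l) \<in> ?R" if "i \<le> l" for l
      using that
    proof (induction l rule: dec_induct)
      case (step l)
      have "(s l, s (Suc l)) \<in> F \<inter> ?S \<times> ?S"
        using sS[of l] sS[of "Suc l"] step.hyps by (simp add: F_def)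
      with step.IH show ?case by (rule rtrancl_into_rtrancl)
    qed auto
    have 2: "(t l, t j) \<in> ?R" if "j \<le> l" for l
      using that
    proof (induction l rule: dec_induct)
      case (step l)
      have "(t (Suc l), t l) \<in> F \<inter> ?S \<times> ?S"
        using tS[of l] tS[of "Suc l"] step.hyps by (simp add: F_def)
      then show ?case using step.IH by (rule converse_rtrancl_into_rtrancl)
    qed auto
    have "s M \<in> A" "t M \<in> A" using A(2,3) M(1) by auto
    then have "(s M, t M) \<in> (E \<inter> A \<times> A)\<^sup>*"
      using A(1) by (simp add: chain_component_def chain_connected_iff)
    moreover have "A \<subseteq> ?S"
      using A(1) by (auto simp: chain_component_def base_nbhd_def)
    then have "(E \<inter> A \<times> A)\<^sup>* \<subseteq> ?R"
      by (intro rtrancl_mono) (auto simp: F_def)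
    ultimately have "(s M, t M) \<in> ?R" by blast
    with 1[OF M(2)] 2[OF M(3)] show "(s i, t j) \<in> ?R"
      by (meson rtrancl_trans)
  qed (rule subset_refl)
  ultimately show ?thesis by blast
qed

section \<open>First-order formulas about pairs, relations and finite sequences\<close>

definition FAll :: "nat \<Rightarrow> fm \<Rightarrow> fm" where "FAll i p = FNeg (FEx i (FNeg p))"
definition FImp :: "fm \<Rightarrow> fm \<Rightarrow> fm" where "FImp p q = FNeg (FConj p (FNeg q))"
definition FDisj :: "fm \<Rightarrow> fm \<Rightarrow> fm" where "FDisj p q = FNeg (FConj (FNeg p) (FNeg q))"
definition FIff :: "fm \<Rightarrow> fm \<Rightarrow> fm" where "FIff p q = FConj (FImp p q) (FImp q p)"

lemma sat_connectives [simp]: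
  "sat m (FAll i p) v \<longleftrightarrow> (\<forall>a. sat m p (v(i := a)))"
  "sat m (FImp p q) v \<longleftrightarrow> (sat m p v \<longrightarrow> sat m q v)"
  "sat m (FDisj p q) v \<longleftrightarrow> (sat m p v \<or> sat m q v)"
  "sat m (FIff p q) v \<longleftrightarrow> (sat m p v \<longleftrightarrow> sat m q v)"
  by (auto simp: FAll_def FImp_def FDisj_def FIff_def)

lemma elts_iff: "x \<in> elts m a \<longleftrightarrow> m x a"
  by (simp add: elts_def)

text \<open>Expresses by quantifiers over elements that \<open>u\<close> is the graph of a function
  on the indices up to and including \<open>n\<close>, so that the notion transfers.\<close>

definition seq_upto :: "('v \<Rightarrow> 'v \<Rightarrow> bool) \<Rightarrow> 'v \<Rightarrow> 'v \<Rightarrow> bool" where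
  "seq_upto m n u \<longleftrightarrow> (\<forall>p. m p u \<longrightarrow> (\<exists>i x. (m i n \<or> i = n) \<and> p = opair m i x)) \<and>
     (\<forall>i. m i n \<or> i = n \<longrightarrow> (\<exists>x. (i, x) \<in> rel_of m u \<and> (\<forall>y. (i, y) \<in> rel_of m u \<longrightarrow> y = x)))"

text \<open>The successor \<open>j\<close> of \<open>i\<close> is given by its elements, because
  \<open>succ\<close> is a definite description and not a formula.\<close>

definition steps :: "('v \<Rightarrow> 'v \<Rightarrow> bool) \<Rightarrow> 'v \<Rightarrow> 'v \<Rightarrow> ('v \<times> 'v) set" where
  "steps m n u = {(a, b). \<exists>i j. m i n \<and> elts m j = insert i (elts m i) \<and>
     (i, a) \<in> rel_of m u \<and> (j, b) \<in> rel_of m u}"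

definition path :: "('v \<Rightarrow> 'v \<Rightarrow> bool) \<Rightarrow> 'v \<Rightarrow> 'v \<Rightarrow> 'v \<Rightarrow> 'v \<Rightarrow> 'v \<Rightarrow> bool" where
  "path m z n u x y \<longleftrightarrow> seq_upto m n u \<and> (z, x) \<in> rel_of m u \<and> (n, y) \<in> rel_of m u"

text \<open>In each formula the bound variables exceed the sum of the free ones, so none is captured.\<close>

definition FPair :: "nat \<Rightarrow> nat \<Rightarrow> nat \<Rightarrow> fm" where
  "FPair p x y = (let w = Suc (p + x + y); t = Suc w in
     FAll w (FIff (FMem w p)
       (FDisj (FAll t (FIff (FMem t w) (FEq t x)))
              (FAll t (FIff (FMem t w) (FDisj (FEq t x) (FEq t y)))))))"

definition FRel :: "nat \<Rightarrow> nat \<Rightarrow> nat \<Rightarrow> fm" where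
  "FRel r x y = (let p = Suc (r + x + y) in FEx p (FConj (FPair p x y) (FMem p r)))"

definition FSucc :: "nat \<Rightarrow> nat \<Rightarrow> fm" where
  "FSucc j i = (let t = Suc (i + j) in
     FAll t (FIff (FMem t j) (FDisj (FEq t i) (FMem t i))))"

definition FSeq :: "nat \<Rightarrow> nat \<Rightarrow> fm" where
  "FSeq n u = (let p = Suc (n + u); i = Suc p; x = Suc i; y = Suc x in
     FConj
       (FAll p (FImp (FMem p u)
         (FEx i (FEx x (FConj (FDisj (FMem i n) (FEq i n)) (FPair p i x))))))
       (FAll i (FImp (FDisj (FMem i n) (FEq i n))
         (FEx x (FConj (FRel u i x) (FAll y (FImp (FRel u i y) (FEq y x))))))))"

definition FStep :: "nat \<Rightarrow> nat \<Rightarrow> nat \<Rightarrow> nat \<Rightarrow> fm" where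
  "FStep n u a b = (let i = Suc (n + u + a + b); j = Suc i in
     FEx i (FEx j (FConj (FConj (FMem i n) (FSucc j i)) (FConj (FRel u i a) (FRel u j b)))))"

definition FPath :: "nat \<Rightarrow> nat \<Rightarrow> nat \<Rightarrow> nat \<Rightarrow> nat \<Rightarrow> fm" where
  "FPath z n u x y = FConj (FSeq n u) (FConj (FRel u z x) (FRel u n y))"

lemma sat_FSucc [simp]:
  "sat m (FSucc j i) v \<longleftrightarrow> elts m (v j) = insert (v i) (elts m (v i))"
  by (simp add: FSucc_def Let_def elts_def set_eq_iff)

text \<open>Both assumptions are first-order and so pass to the extension; the theory of pairs and
  coded functions is thus available in both structures.\<close>

locale pairing_structure =
  fixes m :: "'v \<Rightarrow> 'v \<Rightarrow> bool"
  assumes elts_eqD: "elts m a = elts m b \<Longrightarrow> a = b"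
    and pairs_coded: "coded m {x, y}"
begin

lemma code_elts [simp]: "code m (elts m a) = a"
  unfolding code_def by (rule the_equality) (auto intro: elts_eqD)

lemma elts_code: "coded m A \<Longrightarrow> elts m (code m A) = A"
  unfolding coded_def by auto

lemma code_eqI: "elts m a = A \<Longrightarrow> code m A = a"
  by auto

lemma elts_upair [simp]: "elts m (code m {x, y}) = {x, y}"
  by (simp add: elts_code pairs_coded)

lemma elts_singleton [simp]: "elts m (code m {x}) = {x}"
  using elts_upair[of x x] by simp

lemma eq_iff_elts: "a = b \<longleftrightarrow> elts m a = elts m b"
  using elts_eqD by blast

lemma elts_opair: "elts m (opair m x y) = {code m {x}, code m {x, y}}"
  by (simp add: opair_def)

lemma opair_inject [simp]: "opair m x y = opair m x' y' \<longleftrightarrow> x = x' \<and> y = y'"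
proof
  assume "opair m x y = opair m x' y'"
  then have "{code m {x}, code m {x, y}} = {code m {x'}, code m {x', y'}}"
    by (metis elts_opair)
  then have "elts m ` {code m {x}, code m {x, y}} = elts m ` {code m {x'}, code m {x', y'}}"
    by simp
  then have "{{x}, {x, y}} = {{x'}, {x', y'}}" by simp
  then show "x = x' \<and> y = y'" by (auto simp: doubleton_eq_iff)
qed simp

lemma rel_of_code:
  assumes "coded m (pair_set m R)"
  shows "rel_of m (code m (pair_set m R)) = R"
proof -
  have "(x, y) \<in> rel_of m (code m (pair_set m R)) \<longleftrightarrow> opair m x y \<in> pair_set m R" for x y
    by (simp add: rel_of_def elts_iff[of _ m, symmetric] elts_code[OF assms])
  then show ?thesis by (auto simp: pair_set_def)
qed

text \<open>Eliminates the descriptions in \<open>opair\<close>: the right-hand side is what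
  \<open>FPair\<close> says.\<close>

lemma eq_opair_iff:
  "p = opair m x y \<longleftrightarrow>
     (\<forall>w. m w p \<longleftrightarrow> (\<forall>t. m t w \<longleftrightarrow> t = x) \<or> (\<forall>t. m t w \<longleftrightarrow> t = x \<or> t = y))"
proof -
  have 1: "(\<forall>t. m t w \<longleftrightarrow> t = x) \<longleftrightarrow> w = code m {x}" for w
    unfolding eq_iff_elts[of w] by (auto simp: elts_def set_eq_iff elts_singleton[unfolded elts_def set_eq_iff, simplified])
  have 2: "(\<forall>t. m t w \<longleftrightarrow> t = x \<or> t = y) \<longleftrightarrow> w = code m {x, y}" for w
    unfolding eq_iff_elts[of w] by (auto simp: elts_def set_eq_iff elts_upair[unfolded elts_def set_eq_iff, simplified])
  show ?thesis
    unfolding 1 2 unfolding eq_iff_elts[of p] elts_opair by (auto simp: elts_def)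
qed

lemma sat_FPair [simp]: "sat m (FPair p x y) v \<longleftrightarrow> v p = opair m (v x) (v y)"
  unfolding eq_opair_iff by (simp add: FPair_def Let_def)

lemma sat_FRel [simp]: "sat m (FRel r x y) v \<longleftrightarrow> (v x, v y) \<in> rel_of m (v r)"
  by (simp add: FRel_def Let_def rel_of_def)

lemma sat_FSeq [simp]: "sat m (FSeq n u) v \<longleftrightarrow> seq_upto m (v n) (v u)"
  by (simp add: FSeq_def Let_def seq_upto_def)

lemma sat_FStep [simp]: "sat m (FStep n u a b) v \<longleftrightarrow> (v a, v b) \<in> steps m (v n) (v u)"
  by (simp add: FStep_def Let_def steps_def)

lemma sat_FPath [simp]: "sat m (FPath z n u x y) v \<longleftrightarrow> path m (v z) (v n) (v u) (v x) (v y)"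
  by (simp add: FPath_def path_def)

section \<open>Coded finite sequences as functions\<close>

lemma seq_upto_index:
  assumes "seq_upto m n u" "(i, x) \<in> rel_of m u"
  shows "m i n \<or> i = n"
proof -
  have "m (opair m i x) u" using assms(2) by (simp add: rel_of_def)
  then obtain i' x' where "m i' n \<or> i' = n" "opair m i x = opair m i' x'"
    using assms(1) unfolding seq_upto_def by metis
  then show ?thesis by simp
qed

lemma seq_upto_unique:
  assumes "seq_upto m n u" "(i, x) \<in> rel_of m u" "(i, y) \<in> rel_of m u"
  shows "x = y"
  using assms seq_upto_index[OF assms(1,2)] unfolding seq_upto_def by metis

lemma seq_upto_graph:
  assumes "elts m u = pair_set m (graph_on (insert n (elts m n)) f)"
  shows "seq_upto m n u" "rel_of m u = graph_on (insert n (elts m n)) f"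
proof -
  have "coded m (pair_set m (graph_on (insert n (elts m n)) f))"
    using assms unfolding coded_def by blast
  then show *: "rel_of m u = graph_on (insert n (elts m n)) f"
    using rel_of_code code_eqI[OF assms] by metis
  show "seq_upto m n u"
    unfolding seq_upto_def *
  proof (intro conjI allI impI)
    fix p assume "m p u"
    then have "p \<in> pair_set m (graph_on (insert n (elts m n)) f)"
      by (simp add: assms[symmetric] elts_iff)
    then show "\<exists>i x. (m i n \<or> i = n) \<and> p = opair m i x"
      by (auto simp: graph_on_def pair_set_def elts_iff)
  next
    fix i assume "m i n \<or> i = n"
    then show "\<exists>x. (i, x) \<in> graph_on (insert n (elts m n)) f \<and>
        (\<forall>y. (i, y) \<in> graph_on (insert n (elts m n)) f \<longrightarrow> y = x)"
      by (intro exI[of _ "f i"]) (auto simp: graph_on_def elts_iff)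
  qed
qed

lemma app_eqI:
  assumes "seq_upto m n u" "(i, x) \<in> rel_of m u"
  shows "app m u i = x"
  unfolding app_def using assms seq_upto_unique by blast

lemma seq_upto_app:
  assumes "seq_upto m n u" "m i n \<or> i = n"
  shows "(i, app m u i) \<in> rel_of m u"
proof -
  obtain x where "(i, x) \<in> rel_of m u"
    using assms unfolding seq_upto_def by blast
  with app_eqI[OF assms(1)] show ?thesis by metis
qed

text \<open>Converse to \<open>seq_upto_graph\<close>; together they translate between an element
  coding a sequence and a function whose graph is coded.\<close>

lemma pair_set_graph_app:
  assumes "seq_upto m n u"
  shows "pair_set m (graph_on (insert n (elts m n)) (app m u)) = elts m u"
proof (intro set_eqI iffI)
  fix p assume "p \<in> elts m u"
  then obtain i x where ix: "m i n \<or> i = n" "p = opair m i x"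
    using assms unfolding seq_upto_def elts_iff by blast
  then have "app m u i = x"
    using \<open>p \<in> elts m u\<close> by (intro app_eqI[OF assms]) (auto simp: rel_of_def elts_iff)
  with ix show "p \<in> pair_set m (graph_on (insert n (elts m n)) (app m u))"
    by (auto simp: pair_set_def graph_on_def elts_iff)
next
  fix p assume "p \<in> pair_set m (graph_on (insert n (elts m n)) (app m u))"
  then show "p \<in> elts m u"
    using seq_upto_app[OF assms] by (auto simp: pair_set_def graph_on_def elts_iff rel_of_def)
qed

end

section \<open>The standard universe\<close>

declare num.simps [simp del]

context standard_universe
begin

sublocale std: pairing_structure mem
  by unfold_locales (auto intro: extensional finite_sets)

abbreviation "\<N> \<equiv> code mem (range (num mem))"
abbreviation "rel_code E \<equiv> code mem (pair_set mem E)"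
abbreviation "seq_code s \<equiv> code mem (seq_set mem s)"
abbreviation "ctrl_code P \<equiv> code mem (ctrl_set mem P)"

lemma elts_num: "elts mem (num mem n) = num mem ` {..<n}"
proof (induction n)
  case 0
  then show ?case using std.elts_code[OF finite_sets[of "{}"]] by (simp add: num.simps)
next
  case (Suc n)
  have "elts mem (num mem (Suc n)) = insert (num mem n) (elts mem (num mem n))"
    unfolding num.simps succ_def by (rule std.elts_code, rule finite_sets) (simp add: Suc.IH)
  then show ?case by (simp add: Suc.IH lessThan_Suc)
qed

lemma mem_num_iff: "mem a (num mem n) \<longleftrightarrow> (\<exists>k<n. a = num mem k)"
  using elts_num[of n] by (auto simp: elts_def set_eq_iff)

lemma elts_num_Suc: "elts mem (num mem (Suc n)) = insert (num mem n) (elts mem (num mem n))"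
  by (simp add: elts_num lessThan_Suc)

lemma mem_irrefl: "\<not> mem a a"
  using wf_irrefl[OF well_founded, of a] by simp

text \<open>For distinct indices one numeral would be an element of the other and equal to it,
  against well-foundedness.\<close>

lemma inj_num: "inj (num mem)"
proof (rule injI)
  fix a b assume "num mem a = num mem b"
  then show "a = b"
    using mem_num_iff mem_irrefl by (metis linorder_neqE_nat)
qed

lemma num_eq_iff [simp]: "num mem a = num mem b \<longleftrightarrow> a = b"
  using inj_num by (auto dest: injD)

lemma mem_num_num [simp]: "mem (num mem a) (num mem b) \<longleftrightarrow> a < b"
  by (auto simp: mem_num_iff)

lemma mem_naturals: "mem a \<N> \<longleftrightarrow> (\<exists>k. a = num mem k)"
  using std.elts_code[OF naturals] by (auto simp: elts_def set_eq_iff)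

lemma rel_of_rel_code: "P \<in> CC \<Longrightarrow> E \<in> ctrl P \<Longrightarrow> rel_of mem (rel_code E) = E"
  by (rule std.rel_of_code) (rule controlled_coded)

lemma rel_of_seq_code:
  "P \<in> CC \<Longrightarrow> s \<in> coarse_seqs P \<Longrightarrow> rel_of mem (seq_code s) = range (\<lambda>n. (num mem n, s n))"
  unfolding seq_set_def by (rule std.rel_of_code) (use sequences_coded in \<open>simp add: seq_set_def\<close>)

lemma mem_pts: "P \<in> CC \<Longrightarrow> mem a (code mem (pts P)) \<longleftrightarrow> a \<in> pts P"
  using std.elts_code[OF points_coded] by (auto simp: elts_def set_eq_iff)

lemma mem_ctrl_code: "P \<in> CC \<Longrightarrow> mem d (ctrl_code P) \<longleftrightarrow> (\<exists>E\<in>ctrl P. d = rel_code E)"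
  using std.elts_code[OF structure_coded] by (auto simp: elts_def set_eq_iff ctrl_set_def)

lemma mem_rel_code: "P \<in> CC \<Longrightarrow> E \<in> ctrl P \<Longrightarrow> mem p (rel_code E) \<longleftrightarrow> p \<in> pair_set mem E"
  using std.elts_code[OF controlled_coded] by (auto simp: elts_def set_eq_iff)

text \<open>The graph of a finite chain is a finite set of pairs and therefore an element of the
  universe.\<close>

lemma path_exists:
  assumes "(x, y) \<in> R\<^sup>*" "R \<subseteq> S \<times> S" "x \<in> S"
  shows "\<exists>k w. path mem (num mem 0) (num mem k) w x y \<and>
    (\<forall>i a. (i, a) \<in> rel_of mem w \<longrightarrow> a \<in> S) \<and> steps mem (num mem k) w \<subseteq> R"
proof -
  obtain k where "(x, y) \<in> R ^^ k" using assms(1) rtrancl_imp_relpow by blast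
  then obtain f where f: "f 0 = x" "f k = y" "\<And>i. i < k \<Longrightarrow> (f i, f (Suc i)) \<in> R"
    unfolding relpow_fun_conv by blast
  have fS: "f i \<in> S" if "i \<le> k" for i
  proof (cases i)
    case (Suc l)
    with f(3)[of l] that assms(2) show ?thesis by auto
  qed (use f(1) assms(3) in simp)
  define D where "D = insert (num mem k) (elts mem (num mem k))"
  have D: "D = num mem ` {..k}"
    by (auto simp: D_def elts_num atMost_Suc lessThan_Suc_atMost[symmetric] lessThan_Suc)
  \<comment> \<open>\<open>inv (num mem)\<close> turns a numeral back into the index that it stands
    for.\<close>
  define w where "w = code mem (pair_set mem (graph_on D (\<lambda>i. f (inv (num mem) i))))"
  have w: "elts mem w = pair_set mem (graph_on D (\<lambda>i. f (inv (num mem) i)))"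
    unfolding w_def by (rule std.elts_code, rule finite_sets) (simp add: D pair_set_def graph_on_def)
  note sw = std.seq_upto_graph[OF w[unfolded D_def]]
  have rel: "rel_of mem w = (\<lambda>i. (num mem i, f i)) ` {..k}"
    using sw(2) by (simp add: D_def[symmetric] D graph_on_def image_image inv_f_f[OF inj_num])
  have "path mem (num mem 0) (num mem k) w x y"
    using sw(1) f by (auto simp: path_def rel)
  moreover have "steps mem (num mem k) w \<subseteq> R"
  proof (rule subrelI)
    fix a b assume "(a, b) \<in> steps mem (num mem k) w"
    then obtain i j where ij: "mem i (num mem k)" "elts mem j = insert i (elts mem i)"
      "(i, a) \<in> rel_of mem w" "(j, b) \<in> rel_of mem w"
      unfolding steps_def by blast
    then obtain l where l: "l < k" "i = num mem l" by (auto simp: mem_num_iff)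
    then have "j = num mem (Suc l)"
      using ij(2) by (intro extensional) (simp only: elts_num_Suc)
    with ij l have "a = f l" "b = f (Suc l)" by (auto simp: rel)
    with f(3) l show "(a, b) \<in> R" by simp
  qed
  ultimately show ?thesis
    using fS by (intro exI[of _ k] exI[of _ w]) (auto simp: rel)
qed

text \<open>Ordinary induction along the indices, possible because the length is a standard
  numeral.\<close>

lemma path_imp_rtrancl:
  assumes "path mem (num mem 0) (num mem k) u x y"
  shows "(x, y) \<in> (steps mem (num mem k) u)\<^sup>*"
proof -
  have u: "seq_upto mem (num mem k) u" "(num mem 0, x) \<in> rel_of mem u" "(num mem k, y) \<in> rel_of mem u"
    using assms by (auto simp: path_def)
  have "\<exists>c. (num mem l, c) \<in> rel_of mem u \<and> (x, c) \<in> (steps mem (num mem k) u)\<^sup>*" if "l \<le> k" for l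
    using that
  proof (induction l)
    case 0
    then show ?case using u(2) by blast
  next
    case (Suc l)
    then obtain c where c: "(num mem l, c) \<in> rel_of mem u" "(x, c) \<in> (steps mem (num mem k) u)\<^sup>*"
      by auto
    have "mem (num mem (Suc l)) (num mem k) \<or> num mem (Suc l) = num mem k"
      using Suc.prems by (auto simp only: mem_num_num num_eq_iff)
    then obtain b where b: "(num mem (Suc l), b) \<in> rel_of mem u"
      using std.seq_upto_app[OF u(1)] by blast
    have "(c, b) \<in> steps mem (num mem k) u"
      unfolding steps_def using c b Suc.prems elts_num_Suc[of l]
      by (intro CollectI case_prodI exI[of _ "num mem l"] exI[of _ "num mem (Suc l)"])
        simp
    with c b show ?case by (meson rtrancl_into_rtrancl)
  qed
  from this[of k] obtain c where "(num mem k, c) \<in> rel_of mem u" "(x, c) \<in> (steps mem (num mem k) u)\<^sup>*"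
    by blast
  with std.seq_upto_unique[OF u(1) u(3)] show ?thesis by metis
qed

end

section \<open>The nonstandard extension\<close>

text \<open>Free variables: 0 is the set of naturals, 1 is zero. Bound: 2, 3 the lengths, 4, 5 the
  chains, 6, 7, 8 the end points, 9, 10 the length and code of the composite.\<close>

definition FAppend :: fm where
  "FAppend = FAll 2 (FAll 3 (FAll 4 (FAll 5 (FAll 6 (FAll 7 (FAll 8 (FImp
     (FConj (FConj (FMem 2 0) (FMem 3 0)) (FConj (FPath 1 2 4 6 7) (FPath 1 3 5 7 8)))
     (FEx 9 (FEx 10 (FConj (FMem 9 0) (FConj (FPath 1 9 10 6 8) (FConj
       (FAll 11 (FAll 12 (FImp (FRel 10 11 12)
         (FDisj (FEx 13 (FRel 4 13 12)) (FEx 13 (FRel 5 13 12))))))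
       (FAll 11 (FAll 12 (FImp (FStep 9 10 11 12)
         (FDisj (FStep 2 4 11 12) (FStep 3 5 11 12)))))))))))))))))"

text \<open>The composite uses only values and steps of the two given chains. Hence external
  properties of values and steps are inherited although the formula cannot name them.\<close>

definition appendable :: "('v \<Rightarrow> 'v \<Rightarrow> bool) \<Rightarrow> 'v \<Rightarrow> 'v \<Rightarrow> bool" where
  "appendable m N z \<longleftrightarrow> (\<forall>n n' u u' x y y'. (m n N \<and> m n' N) \<and> path m z n u x y \<and> path m z n' u' y y' \<longrightarrow>
     (\<exists>k w. m k N \<and> path m z k w x y' \<and>
       (\<forall>i a. (i, a) \<in> rel_of m w \<longrightarrow> (\<exists>i. (i, a) \<in> rel_of m u) \<or> (\<exists>i. (i, a) \<in> rel_of m u')) \<and>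
       (\<forall>a b. (a, b) \<in> steps m k w \<longrightarrow> (a, b) \<in> steps m n u \<or> (a, b) \<in> steps m n' u')))"

lemma (in pairing_structure) sat_FAppend: "sat m FAppend v \<longleftrightarrow> appendable m (v 0) (v 1)"
  unfolding FAppend_def appendable_def by simp

text \<open>Variables 0 to 7 are the parameters of \<open>joinable\<close> in order, 8 to 12 are
  \<open>d\<close>, \<open>i\<close>, \<open>j\<close>, \<open>x\<close>, \<open>y\<close>, and 13,
  14 are the length and code of the chain.\<close>

definition FJoin :: fm where
  "FJoin = FAll 8 (FAll 9 (FAll 10 (FAll 11 (FAll 12 (FImp
     (FConj (FConj (FMem 8 3) (FConj (FMem 9 0) (FMem 10 0))) (FConj (FRel 5 9 11) (FRel 6 10 12)))
     (FEx 13 (FEx 14 (FConj (FMem 13 0) (FConj (FPath 1 13 14 11 12) (FConj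
       (FAll 17 (FAll 15 (FImp (FRel 14 17 15) (FConj (FMem 15 7)
         (FDisj (FEx 18 (FConj (FMem 18 0) (FConj (FNeg (FMem 18 9)) (FRel 5 18 15))))
         (FDisj (FEx 18 (FConj (FMem 18 0) (FConj (FNeg (FMem 18 10)) (FRel 6 18 15))))
           (FNeg (FRel 8 15 4))))))))
       (FAll 15 (FAll 16 (FImp (FStep 13 14 15 16) (FRel 2 15 16))))))))))))))"

text \<open>For numerals, \<open>\<not> m l i\<close> means \<open>i \<le> l\<close>. As
  \<open>d\<close> is bounded only by membership in \<open>C\<close>, after transfer it may be any
  internal controlled set, standard or not.\<close>

definition joinable ::
  "('v \<Rightarrow> 'v \<Rightarrow> bool) \<Rightarrow> 'v \<Rightarrow> 'v \<Rightarrow> 'v \<Rightarrow> 'v \<Rightarrow> 'v \<Rightarrow> 'v \<Rightarrow> 'v \<Rightarrow> 'v \<Rightarrow> bool" where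
  "joinable m N z E C xi s t X \<longleftrightarrow> (\<forall>d i j x y. (m d C \<and> m i N \<and> m j N) \<and>
     (i, x) \<in> rel_of m s \<and> (j, y) \<in> rel_of m t \<longrightarrow>
     (\<exists>k w. m k N \<and> path m z k w x y \<and>
       (\<forall>h a. (h, a) \<in> rel_of m w \<longrightarrow> m a X \<and>
         ((\<exists>l. m l N \<and> \<not> m l i \<and> (l, a) \<in> rel_of m s) \<or>
          (\<exists>l. m l N \<and> \<not> m l j \<and> (l, a) \<in> rel_of m t) \<or> (a, xi) \<notin> rel_of m d)) \<and>
       (\<forall>a b. (a, b) \<in> steps m k w \<longrightarrow> (a, b) \<in> rel_of m E)))"

lemma (in pairing_structure) sat_FJoin:
  "sat m FJoin v \<longleftrightarrow> joinable m (v 0) (v 1) (v 2) (v 3) (v 4) (v 5) (v 6) (v 7)"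
  unfolding FJoin_def joinable_def by simp

context standard_universe
begin

text \<open>Both chains are decoded into reflexive transitive closures, composed there and coded
  again, which avoids shifting indices.\<close>

lemma appendable_std: "appendable mem \<N> (num mem 0)"
  unfolding appendable_def
proof (intro allI impI, elim conjE)
  fix n n' u u' x y y'
  assume "mem n \<N>" "mem n' \<N>" and p: "path mem (num mem 0) n u x y" and p': "path mem (num mem 0) n' u' y y'"
  then obtain k k' where k: "n = num mem k" "n' = num mem k'" by (auto simp: mem_naturals)
  define R where "R = steps mem n u \<union> steps mem n' u'"
  define S where "S = {a. (\<exists>i. (i, a) \<in> rel_of mem u) \<or> (\<exists>i. (i, a) \<in> rel_of mem u')}"
  have "(x, y) \<in> R\<^sup>*" "(y, y') \<in> R\<^sup>*"
    using path_imp_rtrancl[OF p[unfolded k]] path_imp_rtrancl[OF p'[unfolded k]]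
      rtrancl_mono[of "steps mem n u" R] rtrancl_mono[of "steps mem n' u'" R]
    by (auto simp: R_def k)
  then have xy: "(x, y') \<in> R\<^sup>*" by (rule rtrancl_trans)
  have RS: "R \<subseteq> S \<times> S" by (auto simp: R_def S_def steps_def)
  have xS: "x \<in> S" using p by (auto simp: S_def path_def)
  obtain l w where "path mem (num mem 0) (num mem l) w x y'"
      "\<forall>i a. (i, a) \<in> rel_of mem w \<longrightarrow> a \<in> S" "steps mem (num mem l) w \<subseteq> R"
    using path_exists[OF xy RS xS] by (elim exE conjE)
  then show "\<exists>k w. mem k \<N> \<and> path mem (num mem 0) k w x y' \<and>
       (\<forall>i a. (i, a) \<in> rel_of mem w \<longrightarrow> (\<exists>i. (i, a) \<in> rel_of mem u) \<or> (\<exists>i. (i, a) \<in> rel_of mem u')) \<and>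
       (\<forall>a b. (a, b) \<in> steps mem k w \<longrightarrow> (a, b) \<in> steps mem n u \<or> (a, b) \<in> steps mem n' u')"
    by (intro exI[of _ "num mem l"] exI[of _ w]) (auto simp: S_def R_def mem_naturals)
qed

text \<open>The coded form of \<open>epsilon_rel_chain\<close>, with \<open>E\<close> still chosen
  before \<open>d\<close>, \<open>i\<close> and \<open>j\<close>.\<close>

lemma joinable_std:
  assumes P: "P \<in> CC" and st: "(s, t) \<in> epsilon_rel P"
  shows "\<exists>E\<in>ctrl P. joinable mem \<N> (num mem 0) (rel_code E) (ctrl_code P) (base P)
    (seq_code s) (seq_code t) (code mem (pts P))"
proof -
  have s: "s \<in> coarse_seqs P" and t: "t \<in> coarse_seqs P"
    using epsilon_rel_coarse_seqs[OF st] by auto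
  obtain E where E: "E \<in> ctrl P" "\<forall>D\<in>ctrl P. \<forall>i j. \<exists>S \<subseteq> {a \<in> pts P. (\<exists>l\<ge>i. a = s l) \<or>
      (\<exists>l\<ge>j. a = t l) \<or> (a, base P) \<notin> D}. s i \<in> S \<and> (s i, t j) \<in> (E \<inter> S \<times> S)\<^sup>*"
    using epsilon_rel_chain[OF spaces[OF P] st] ..
  have "joinable mem \<N> (num mem 0) (rel_code E) (ctrl_code P) (base P)
    (seq_code s) (seq_code t) (code mem (pts P))"
    unfolding joinable_def
  proof (intro allI impI, elim conjE)
    fix d i j x y
    assume "mem d (ctrl_code P)" "mem i \<N>" "mem j \<N>"
      "(i, x) \<in> rel_of mem (seq_code s)" "(j, y) \<in> rel_of mem (seq_code t)"
    then obtain D i' j' where D: "D \<in> ctrl P" "d = rel_code D" and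
      ij: "i = num mem i'" "j = num mem j'" "x = s i'" "y = t j'"
      by (auto simp: mem_ctrl_code[OF P] rel_of_seq_code[OF P s] rel_of_seq_code[OF P t])
    obtain S where S: "S \<subseteq> {a \<in> pts P. (\<exists>l\<ge>i'. a = s l) \<or> (\<exists>l\<ge>j'. a = t l) \<or> (a, base P) \<notin> D}"
      "s i' \<in> S" "(s i', t j') \<in> (E \<inter> S \<times> S)\<^sup>*"
      using E(2)[THEN bspec, OF D(1), THEN spec, THEN spec, of i' j'] by (elim exE conjE)
    obtain k w where kw: "path mem (num mem 0) (num mem k) w (s i') (t j')"
      "\<forall>i a. (i, a) \<in> rel_of mem w \<longrightarrow> a \<in> S" "steps mem (num mem k) w \<subseteq> E \<inter> S \<times> S"
      using path_exists[OF S(3) Int_lower2 S(2)] by (elim exE conjE)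
    have S': "mem a (code mem (pts P)) \<and>
         ((\<exists>l. mem l \<N> \<and> \<not> mem l i \<and> (l, a) \<in> rel_of mem (seq_code s)) \<or>
          (\<exists>l. mem l \<N> \<and> \<not> mem l j \<and> (l, a) \<in> rel_of mem (seq_code t)) \<or> (a, base P) \<notin> rel_of mem d)"
      if "a \<in> S" for a
    proof -
      have "a \<in> pts P" "(\<exists>l\<ge>i'. a = s l) \<or> (\<exists>l\<ge>j'. a = t l) \<or> (a, base P) \<notin> D"
        using that S(1) by auto
      then show ?thesis
        unfolding rel_of_seq_code[OF P s] rel_of_seq_code[OF P t] D(2) rel_of_rel_code[OF P D(1)] ij
          mem_pts[OF P] mem_naturals
        by (elim disjE) (fastforce simp: not_less[symmetric])+
    qed
    show "\<exists>k w. mem k \<N> \<and> path mem (num mem 0) k w x y \<and>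
       (\<forall>h a. (h, a) \<in> rel_of mem w \<longrightarrow> mem a (code mem (pts P)) \<and>
         ((\<exists>l. mem l \<N> \<and> \<not> mem l i \<and> (l, a) \<in> rel_of mem (seq_code s)) \<or>
          (\<exists>l. mem l \<N> \<and> \<not> mem l j \<and> (l, a) \<in> rel_of mem (seq_code t)) \<or>
          (a, base P) \<notin> rel_of mem d)) \<and>
       (\<forall>a b. (a, b) \<in> steps mem k w \<longrightarrow> (a, b) \<in> rel_of mem (rel_code E))"
    proof (intro exI conjI)
      show "mem (num mem k) \<N>" by (auto simp: mem_naturals)
      show "path mem (num mem 0) (num mem k) w x y" using kw(1) ij by simp
      show "\<forall>h a. (h, a) \<in> rel_of mem w \<longrightarrow> mem a (code mem (pts P)) \<and>
         ((\<exists>l. mem l \<N> \<and> \<not> mem l i \<and> (l, a) \<in> rel_of mem (seq_code s)) \<or>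
          (\<exists>l. mem l \<N> \<and> \<not> mem l j \<and> (l, a) \<in> rel_of mem (seq_code t)) \<or>
          (a, base P) \<notin> rel_of mem d)"
        using kw(2) S' by blast
      show "\<forall>a b. (a, b) \<in> steps mem (num mem k) w \<longrightarrow> (a, b) \<in> rel_of mem (rel_code E)"
        using kw(3) rel_of_rel_code[OF P E(1)] by blast
    qed
  qed
  then show ?thesis using E(1) by (intro bexI[of _ E])
qed

end

context nonstandard_setting
begin

lemma smem_star [simp]: "smem (star a) (star b) \<longleftrightarrow> mem a b"
  using elementary[of "FMem 0 1" "(\<lambda>_. a)(1 := b)"] by simp

text \<open>Extensionality and pairing are closed formulas, so they are transferred under an
  arbitrary valuation.\<close>

sublocale nst: pairing_structure smem
proof
  have "sat mem (FAll 0 (FAll 1 (FImp (FAll 2 (FIff (FMem 2 0) (FMem 2 1))) (FEq 0 1)))) undefined"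
    using std.eq_iff_elts by (auto simp: elts_def set_eq_iff)
  then have "sat smem (FAll 0 (FAll 1 (FImp (FAll 2 (FIff (FMem 2 0) (FMem 2 1))) (FEq 0 1))))
      (\<lambda>i. star (undefined i))"
    by (simp only: elementary)
  then show "a = b" if "elts smem a = elts smem b" for a b
    using that by (simp add: elts_def set_eq_iff)
  have "sat mem (FAll 0 (FAll 1 (FEx 2 (FAll 3 (FIff (FMem 3 2) (FDisj (FEq 3 0) (FEq 3 1))))))) undefined"
    using std.elts_upair by (fastforce simp: elts_def set_eq_iff)
  then have "sat smem (FAll 0 (FAll 1 (FEx 2 (FAll 3 (FIff (FMem 3 2) (FDisj (FEq 3 0) (FEq 3 1)))))))
      (\<lambda>i. star (undefined i))"
    by (simp only: elementary)
  then show "coded smem {x, y}" for x y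
    by (simp add: coded_def elts_def set_eq_iff)
qed

abbreviation "hN \<equiv> hypernats mem smem star"
abbreviation "inf_pts \<equiv> INF_pts mem smem star"

section \<open>Hypernaturals and the existence of infinite ones\<close>

lemma hypernats_iff: "i \<in> hN \<longleftrightarrow> smem i (star \<N>)"
  by (simp add: hypernats_def star_set_def elts_def)

lemma elts_star_num_Suc:
  "elts smem (star (num mem (Suc k))) = insert (star (num mem k)) (elts smem (star (num mem k)))"
  using elementary[of "FSucc 0 1" "(\<lambda>_. num mem (Suc k))(1 := num mem k)"] elts_num_Suc[of k]
  by simp

text \<open>A standard numeral gains no elements in the extension, so whatever lies below it is
  again a standard numeral.\<close>

lemma elts_star_num: "elts smem (star (num mem k)) = (\<lambda>l. star (num mem l)) ` {..<k}"
proof (induction k)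
  case 0
  have "\<not> smem a (star (num mem 0))" for a
    using elementary[of "FAll 1 (FNeg (FMem 1 0))" "\<lambda>_. num mem 0"]
    by (simp add: mem_num_iff)
  then show ?case by (auto simp: elts_def)
qed (simp add: elts_star_num_Suc lessThan_Suc)

lemma smem_star_num_iff: "smem a (star (num mem k)) \<longleftrightarrow> (\<exists>l<k. a = star (num mem l))"
  using elts_star_num[of k] by (auto simp: elts_def set_eq_iff)

lemma infinite_hypernats_iff:
  "i \<in> infinite_hypernats mem smem star \<longleftrightarrow> i \<in> hN \<and> (\<forall>k. i \<noteq> star (num mem k))"
  by (auto simp: infinite_hypernats_def)

text \<open>If \<open>l\<close> were the numeral \<open>k\<close>, the transferred comparison of
  naturals with \<open>k\<close> would put \<open>i\<close> below \<open>Suc k\<close>, and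
  \<open>i\<close> would be standard.\<close>

lemma infinite_hypernats_upward:
  assumes i: "i \<in> infinite_hypernats mem smem star" and l: "l \<in> hN" "\<not> smem l i"
  shows "l \<in> infinite_hypernats mem smem star"
  unfolding infinite_hypernats_iff
proof (intro conjI l(1) allI notI)
  fix k assume k: "l = star (num mem k)"
  have "sat mem (FAll 2 (FImp (FMem 2 0) (FDisj (FMem 1 2) (FMem 2 3))))
      ((\<lambda>_. \<N>)(1 := num mem k, 3 := num mem (Suc k)))"
    by (auto simp: mem_naturals)
  then have "smem i (star (num mem (Suc k)))"
    using elementary[of "FAll 2 (FImp (FMem 2 0) (FDisj (FMem 1 2) (FMem 2 3)))"
        "(\<lambda>_. \<N>)(1 := num mem k, 3 := num mem (Suc k))"] i l(2)
    by (auto simp: infinite_hypernats_iff hypernats_iff k)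
  then show False using i by (auto simp: smem_star_num_iff infinite_hypernats_iff)
qed

text \<open>Saturation for a family of standard sets: the finite intersection property needs only
  standard witnesses.\<close>

lemma enlargement:
  assumes "\<And>J. finite J \<Longrightarrow> J \<subseteq> elts mem a \<Longrightarrow> \<exists>x. \<forall>j\<in>J. mem x (G j)"
  shows "\<exists>y. \<forall>j. mem j a \<longrightarrow> smem y (star (G j))"
proof -
  have "(\<Inter>j\<in>J. elts smem (star (G j))) \<noteq> {}" if J: "finite J" "J \<subseteq> elts mem a" for J
  proof -
    obtain x where "\<forall>j\<in>J. mem x (G j)" using assms[OF J] ..
    then have "star x \<in> (\<Inter>j\<in>J. elts smem (star (G j)))" by (simp add: elts_def)
    then show ?thesis by blast
  qed
  from saturated[of a "\<lambda>j. star (G j)", OF this] obtain y where "y \<in> (\<Inter>j\<in>elts mem a. elts smem (star (G j)))"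
    by auto
  then show ?thesis by (auto simp: elts_def)
qed

text \<open>Saturation is applied to the sets \<open>G j\<close> of naturals not below
  \<open>j\<close>. Without an infinite index the descriptions in \<open>omega\<close> and
  \<open>omega'\<close> would have no candidate.\<close>

lemma infinite_hypernats_nonempty: "\<exists>i. i \<in> infinite_hypernats mem smem star"
proof -
  define G where "G j = code mem {x \<in> elts mem \<N>. \<not> mem x j}" for j
  have "coded mem {x \<in> elts mem \<N>. \<not> mem x j}" for j
    using separation[of \<N> "FNeg (FMem 0 1)" "\<lambda>_. j" 0] by simp
  from std.elts_code[OF this] have G: "mem x (G j) \<longleftrightarrow> mem x \<N> \<and> \<not> mem x j" for x j
    by (auto simp: G_def elts_def set_eq_iff)
  have "\<exists>x. \<forall>j\<in>J. mem x (G j)" if "finite J" "J \<subseteq> elts mem \<N>" for J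
  proof -
    have "J \<subseteq> range (num mem)" using that(2) by (auto simp: elts_def mem_naturals)
    with that(1) obtain J' where J': "finite J'" "J = num mem ` J'"
      by (meson finite_subset_image)
    then obtain K where "\<forall>j\<in>J'. j < K" using finite_nat_set_iff_bounded by blast
    then have "\<forall>j\<in>J. mem (num mem K) (G j)"
      by (auto simp: G J' mem_naturals)
    then show ?thesis ..
  qed
  from enlargement[OF this] obtain y where y: "\<forall>j. mem j \<N> \<longrightarrow> smem y (star (G j))" ..
  have "smem y (star \<N>) \<and> \<not> smem y (star (num mem k))" for k
  proof -
    have "smem x (star (G (num mem k))) \<longrightarrow> smem x (star \<N>) \<and> \<not> smem x (star (num mem k))" for x
      using elementary[of "FAll 3 (FImp (FMem 3 0) (FConj (FMem 3 1) (FNeg (FMem 3 2))))"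
          "(\<lambda>_. G (num mem k))(1 := \<N>, 2 := num mem k)"]
      by (simp add: G)
    moreover have "smem y (star (G (num mem k)))"
      using y by (auto simp: mem_naturals)
    ultimately show ?thesis by blast
  qed
  \<comment> \<open>The numeral \<open>k\<close> is an element of \<open>Suc k\<close>, whereas
    \<open>y\<close> is not.\<close>
  moreover from this have "y \<noteq> star (num mem k)" for k
    using smem_star[of "num mem k" "num mem (Suc k)"] by (metis lessI mem_num_num)
  ultimately have "y \<in> infinite_hypernats mem smem star"
    by (auto simp: infinite_hypernats_iff hypernats_iff)
  then show ?thesis ..
qed

lemma star_rel_eq: "star_rel mem smem star E = rel_of smem (star (rel_code E))"
  by (simp add: star_rel_def)

text \<open>Here \<open>G j\<close> collects the controlled sets above \<open>j\<close>, and finite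
  unions are the witnesses. A point that is not \<open>D\<close>-related to the base point is then
  infinite.\<close>

lemma controlled_upper_bound:
  assumes P: "P \<in> CC"
  shows "\<exists>D. smem D (star (ctrl_code P)) \<and> (\<forall>E\<in>ctrl P. star_rel mem smem star E \<subseteq> rel_of smem D)"
proof -
  define G where "G j = code mem {d \<in> elts mem (ctrl_code P). \<forall>p. mem p j \<longrightarrow> mem p d}" for j
  have "coded mem {d \<in> elts mem (ctrl_code P). \<forall>p. mem p j \<longrightarrow> mem p d}" for j
    using separation[of "ctrl_code P" "FAll 2 (FImp (FMem 2 1) (FMem 2 0))" "\<lambda>_. j" 0] by simp
  from std.elts_code[OF this]
  have G: "mem d (G j) \<longleftrightarrow> mem d (ctrl_code P) \<and> (\<forall>p. mem p j \<longrightarrow> mem p d)" for d j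
    by (auto simp: G_def elts_def set_eq_iff)
  have "\<exists>d. \<forall>j\<in>J. mem d (G j)" if "finite J" "J \<subseteq> elts mem (ctrl_code P)" for J
  proof -
    have "J \<subseteq> rel_code ` ctrl P" using that(2) by (auto simp: elts_def mem_ctrl_code[OF P])
    with that(1) obtain \<E> where \<E>: "\<E> \<subseteq> ctrl P" "finite \<E>" "J = rel_code ` \<E>"
      by (meson finite_subset_image)
    have U: "\<Union>\<E> \<in> ctrl P" by (rule controlled_Union[OF spaces[OF P] \<E>(2,1)])
    have "mem (rel_code (\<Union>\<E>)) (G (rel_code E))" if "E \<in> \<E>" for E
    proof -
      have "pair_set mem E \<subseteq> pair_set mem (\<Union>\<E>)"
        using that by (auto simp: pair_set_def)
      moreover have "E \<in> ctrl P" using that \<E>(1) by blast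
      ultimately show ?thesis
        using U by (auto simp: G mem_ctrl_code[OF P] mem_rel_code[OF P])
    qed
    then show ?thesis using \<E>(3) by blast
  qed
  from enlargement[OF this] obtain D where D: "\<forall>j. mem j (ctrl_code P) \<longrightarrow> smem D (star (G j))" ..
  have DE: "smem D (star (ctrl_code P)) \<and> star_rel mem smem star E \<subseteq> rel_of smem D" if E: "E \<in> ctrl P" for E
  proof -
    have "smem d (star (G (rel_code E))) \<longrightarrow>
        smem d (star (ctrl_code P)) \<and> (\<forall>p. smem p (star (rel_code E)) \<longrightarrow> smem p d)" for d
      using elementary[of "FAll 3 (FImp (FMem 3 0) (FConj (FMem 3 1) (FAll 4 (FImp (FMem 4 2) (FMem 4 3)))))"
          "(\<lambda>_. G (rel_code E))(1 := ctrl_code P, 2 := rel_code E)"]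
      by (simp add: G)
    moreover have "smem D (star (G (rel_code E)))"
      using D E by (auto simp: mem_ctrl_code[OF P])
    ultimately show ?thesis by (auto simp: star_rel_eq rel_of_def)
  qed
  \<comment> \<open>Some controlled set must exist before \<open>DE\<close> yields that
    \<open>D\<close> is an internal controlled set.\<close>
  have "Id_on (pts P) \<in> ctrl P" by (rule pointed_coarse_spaceD(4)[OF spaces[OF P]])
  with DE show ?thesis by blast
qed

lemma star_seq_rel:
  assumes "P \<in> CC" "s \<in> coarse_seqs P" "i \<in> hN"
  shows "(i, star_seq mem smem star s i) \<in> rel_of smem (star (seq_code s))"
proof -
  have "mem j \<N> \<longrightarrow> (\<exists>x. (j, x) \<in> rel_of mem (seq_code s) \<and>
      (\<forall>y. (j, y) \<in> rel_of mem (seq_code s) \<longrightarrow> y = x))" for j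
    by (force simp: rel_of_seq_code[OF assms(1,2)] mem_naturals)
  then have "\<exists>x. (i, x) \<in> rel_of smem (star (seq_code s)) \<and>
      (\<forall>y. (i, y) \<in> rel_of smem (star (seq_code s)) \<longrightarrow> y = x)"
    using elementary[of "FAll 2 (FImp (FMem 2 0) (FEx 3 (FConj (FRel 1 2 3)
        (FAll 4 (FImp (FRel 1 2 4) (FEq 4 3))))))" "(\<lambda>_. \<N>)(1 := seq_code s)"] assms(3)
    by (simp add: hypernats_iff)
  then have "\<exists>!x. (i, x) \<in> rel_of smem (star (seq_code s))" by blast
  then show ?thesis unfolding star_seq_def app_def by (rule theI')
qed

text \<open>Properness gives a standard \<open>K\<close> such that \<open>E\<close>-closeness of
  \<open>s k\<close> to the base point forces \<open>k < K\<close>. By transfer an index with a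
  value that close lies below \<open>K\<close>, hence is not infinite.\<close>

lemma star_seq_in_INF:
  assumes P: "P \<in> CC" and s: "s \<in> coarse_seqs P" and l: "l \<in> infinite_hypernats mem smem star"
    and a: "(l, a) \<in> rel_of smem (star (seq_code s))"
  shows "a \<in> inf_pts P"
proof -
  have "smem a (star (code mem (pts P)))"
    using elementary[of "FAll 2 (FAll 3 (FImp (FRel 1 2 3) (FMem 3 0)))"
        "(\<lambda>_. code mem (pts P))(1 := seq_code s)"] a
    by (auto simp: rel_of_seq_code[OF P s] mem_pts[OF P] coarse_seq_in_pts[OF s])
  moreover have "(a, star (base P)) \<notin> star_rel mem smem star E" if E: "E \<in> ctrl P" for E
  proof
    assume aE: "(a, star (base P)) \<in> star_rel mem smem star E"
    obtain K where K: "\<And>k. K \<le> k \<Longrightarrow> s k \<notin> base_nbhd P E"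
      by (rule coarse_seq_eventually_outside[OF s bounded_base_nbhd[OF spaces[OF P] E]]) blast
    then have "k < K" if "(s k, base P) \<in> E" for k
      using that by (force simp: base_nbhd_def not_less[symmetric])
    then have "smem l (star (num mem K))"
      using elementary[of "FAll 5 (FAll 6 (FImp (FConj (FRel 0 5 6) (FRel 1 6 2)) (FMem 5 3)))"
        "(\<lambda>_. seq_code s)(1 := rel_code E, 2 := base P, 3 := num mem K)"] a aE
      by (auto simp: rel_of_seq_code[OF P s] rel_of_rel_code[OF P E] star_rel_eq)
    with l show False by (auto simp: smem_star_num_iff infinite_hypernats_iff)
  qed
  ultimately show ?thesis
    by (auto simp: INF_pts_def star_set_def elts_def finitely_close_def)
qed

section \<open>Internal chains of infinite points\<close>

lemma zero_le_hypernat: "n \<in> hN \<Longrightarrow> smem (star (num mem 0)) n \<or> star (num mem 0) = n"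
proof -
  have "mem (num mem 0) k \<or> num mem 0 = k" if "mem k \<N>" for k
    using that by (auto simp: mem_naturals)
  then show "n \<in> hN \<Longrightarrow> smem (star (num mem 0)) n \<or> star (num mem 0) = n"
    using elementary[of "FAll 2 (FImp (FMem 2 0) (FDisj (FMem 1 2) (FEq 1 2)))" "(\<lambda>_. \<N>)(1 := num mem 0)"]
    by (simp add: hypernats_iff)
qed

text \<open>The successor exists by transfer, and extensionality identifies it with the description
  \<open>succ\<close>. Being at most \<open>n\<close>, it stays in the domain of a sequence up to
  \<open>n\<close>.\<close>

lemma hypernat_succ:
  assumes "n \<in> hN" "smem i n"
  shows "elts smem (succ smem i) = insert i (elts smem i)" "smem (succ smem i) n \<or> succ smem i = n"
proof -
  have "\<exists>j. elts mem j = insert i (elts mem i) \<and> (mem j k \<or> j = k)" if k: "mem k \<N>" and ik: "mem i k" for i k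
  proof -
    obtain b where b: "k = num mem b" using k by (auto simp: mem_naturals)
    then obtain a where "i = num mem a" "a < b" using ik by (auto simp: mem_num_iff)
    with b have "elts mem (num mem (Suc a)) = insert i (elts mem i) \<and>
        (mem (num mem (Suc a)) k \<or> num mem (Suc a) = k)"
      using elts_num_Suc[of a] by auto
    then show ?thesis ..
  qed
  then have "\<exists>j. elts smem j = insert i (elts smem i) \<and> (smem j n \<or> j = n)"
    using elementary[of "FAll 2 (FImp (FMem 2 0) (FAll 3 (FImp (FMem 3 2)
      (FEx 4 (FConj (FSucc 4 3) (FDisj (FMem 4 2) (FEq 4 2)))))))" "\<lambda>_. \<N>"] assms
    by (simp add: hypernats_iff)
  then obtain j where j: "elts smem j = insert i (elts smem i)" "smem j n \<or> j = n" by blast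
  have "succ smem i = j" unfolding succ_def using nst.code_eqI[OF j(1)] .
  with j show "elts smem (succ smem i) = insert i (elts smem i)" "smem (succ smem i) n \<or> succ smem i = n"
    by simp_all
qed

text \<open>Transfer yields an element \<open>w\<close>, whereas \<open>iota_rel\<close> asks for a
  function with internal graph; \<open>app smem w\<close> is such a function, as its graph is
  \<open>w\<close> again.\<close>

lemma iota_relI:
  assumes n: "n \<in> hN" and path: "path smem (star (num mem 0)) n w x y"
    and inf: "\<And>i a. (i, a) \<in> rel_of smem w \<Longrightarrow> a \<in> inf_pts P"
    and close: "\<And>a b. (a, b) \<in> steps smem n w \<Longrightarrow> finitely_close mem smem star P a b"
  shows "(x, y) \<in> iota_rel mem smem star P"
proof -
  have w: "seq_upto smem n w" "(star (num mem 0), x) \<in> rel_of smem w" "(n, y) \<in> rel_of smem w"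
    using path by (auto simp: path_def)
  let ?u = "app smem w"
  have rel: "(i, ?u i) \<in> rel_of smem w" if "smem i n \<or> i = n" for i
    by (rule nst.seq_upto_app[OF w(1) that])
  have "coded smem (pair_set smem (graph_on (insert n (elts smem n)) ?u))"
    unfolding nst.pair_set_graph_app[OF w(1)] by (auto simp: coded_def)
  moreover have "?u i \<in> inf_pts P" if "i \<in> insert n (elts smem n)" for i
    by (rule inf[OF rel]) (use that in \<open>auto simp: elts_iff\<close>)
  moreover have "?u (star (num mem 0)) = x" "?u n = y"
    using w by (auto intro: nst.app_eqI)
  moreover have "finitely_close mem smem star P (?u i) (?u (succ smem i))" if "i \<in> elts smem n" for i
  proof (rule close)
    have i: "smem i n" using that by (simp add: elts_iff)
    show "(?u i, ?u (succ smem i)) \<in> steps smem n w"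
      unfolding steps_def using i hypernat_succ[OF n i] rel by blast
  qed
  ultimately show ?thesis
    unfolding iota_rel_def using n by (intro CollectI case_prodI bexI[of _ n] exI[of _ ?u]) auto
qed

lemma iota_relD:
  assumes "(x, y) \<in> iota_rel mem smem star P"
  shows "\<exists>n w. n \<in> hN \<and> path smem (star (num mem 0)) n w x y \<and>
    (\<forall>i a. (i, a) \<in> rel_of smem w \<longrightarrow> a \<in> inf_pts P) \<and>
    (\<forall>a b. (a, b) \<in> steps smem n w \<longrightarrow> finitely_close mem smem star P a b)"
proof -
  obtain n u where n: "n \<in> hN" and u: "coded smem (pair_set smem (graph_on (insert n (elts smem n)) u))"
    "\<And>i. i \<in> insert n (elts smem n) \<Longrightarrow> u i \<in> inf_pts P" "u (star (num mem 0)) = x" "u n = y"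
    "\<And>i. i \<in> elts smem n \<Longrightarrow> finitely_close mem smem star P (u i) (u (succ smem i))"
    using assms unfolding iota_rel_def by auto
  obtain w where w: "elts smem w = pair_set smem (graph_on (insert n (elts smem n)) u)"
    using u(1) unfolding coded_def by blast
  note sw = nst.seq_upto_graph[OF w]
  have rel: "(i, a) \<in> rel_of smem w \<longleftrightarrow> (smem i n \<or> i = n) \<and> a = u i" for i a
    unfolding sw(2) by (auto simp: graph_on_def elts_iff)
  have "path smem (star (num mem 0)) n w x y"
    using sw(1) u(3,4) zero_le_hypernat[OF n] by (simp add: path_def rel)
  moreover have "\<forall>i a. (i, a) \<in> rel_of smem w \<longrightarrow> a \<in> inf_pts P"
    using u(2) by (auto simp: rel elts_iff)
  moreover have "finitely_close mem smem star P a b" if ab: "(a, b) \<in> steps smem n w" for a b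
  proof -
    obtain i j where ij: "smem i n" "elts smem j = insert i (elts smem i)" "a = u i" "b = u j"
      using ab unfolding steps_def rel by blast
    have "j = succ smem i" unfolding succ_def using nst.code_eqI[OF ij(2)] by simp
    with ij u(5) show ?thesis by (simp add: elts_iff)
  qed
  ultimately show ?thesis using n by blast
qed

lemma iota_rel_trans:
  assumes "(x, y) \<in> iota_rel mem smem star P" "(y, y') \<in> iota_rel mem smem star P"
  shows "(x, y') \<in> iota_rel mem smem star P"
proof -
  obtain n u where u: "n \<in> hN" "path smem (star (num mem 0)) n u x y"
    "\<forall>i a. (i, a) \<in> rel_of smem u \<longrightarrow> a \<in> inf_pts P"
    "\<forall>a b. (a, b) \<in> steps smem n u \<longrightarrow> finitely_close mem smem star P a b"
    using iota_relD[OF assms(1)] by (elim exE conjE)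
  obtain n' u' where u': "n' \<in> hN" "path smem (star (num mem 0)) n' u' y y'"
    "\<forall>i a. (i, a) \<in> rel_of smem u' \<longrightarrow> a \<in> inf_pts P"
    "\<forall>a b. (a, b) \<in> steps smem n' u' \<longrightarrow> finitely_close mem smem star P a b"
    using iota_relD[OF assms(2)] by (elim exE conjE)
  have "appendable smem (star \<N>) (star (num mem 0))"
    using elementary[of FAppend "(\<lambda>_. \<N>)(1 := num mem 0)"] appendable_std
    by (simp add: std.sat_FAppend nst.sat_FAppend)
  then have "\<exists>k w. smem k (star \<N>) \<and> path smem (star (num mem 0)) k w x y' \<and>
       (\<forall>i a. (i, a) \<in> rel_of smem w \<longrightarrow> (\<exists>i. (i, a) \<in> rel_of smem u) \<or> (\<exists>i. (i, a) \<in> rel_of smem u')) \<and>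
       (\<forall>a b. (a, b) \<in> steps smem k w \<longrightarrow> (a, b) \<in> steps smem n u \<or> (a, b) \<in> steps smem n' u')"
    unfolding appendable_def using u(1,2) u'(1,2) unfolding hypernats_iff by blast
  then obtain k w where w: "smem k (star \<N>)" "path smem (star (num mem 0)) k w x y'"
    "\<forall>i a. (i, a) \<in> rel_of smem w \<longrightarrow> (\<exists>i. (i, a) \<in> rel_of smem u) \<or> (\<exists>i. (i, a) \<in> rel_of smem u')"
    "\<forall>a b. (a, b) \<in> steps smem k w \<longrightarrow> (a, b) \<in> steps smem n u \<or> (a, b) \<in> steps smem n' u'"
    by (elim exE conjE)
  show ?thesis
  proof (rule iota_relI[OF _ w(2)])
    show "k \<in> hN" using w(1) by (simp add: hypernats_iff)
    show "a \<in> inf_pts P" if "(i, a) \<in> rel_of smem w" for i a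
      using w(3) that u(3) u'(3) by blast
    show "finitely_close mem smem star P a b" if "(a, b) \<in> steps smem k w" for a b
      using w(4) that u(4) u'(4) by blast
  qed
qed

text \<open>Each point of the transferred chain is infinite for one of three reasons: it is a value
  of \<open>s\<close> at an index not below \<open>i\<close>, or of \<open>t\<close> at one not
  below \<open>j\<close>, and such indices are infinite; or it is not \<open>D\<close>-related to
  the base point.\<close>

lemma iota_rel_star_seq:
  assumes P: "P \<in> CC" and st: "(s, t) \<in> epsilon_rel P"
    and i: "i \<in> infinite_hypernats mem smem star" and j: "j \<in> infinite_hypernats mem smem star"
  shows "(star_seq mem smem star s i, star_seq mem smem star t j) \<in> iota_rel mem smem star P"
    (is "(?x, ?y) \<in> _")
proof -
  have s: "s \<in> coarse_seqs P" and t: "t \<in> coarse_seqs P"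
    using epsilon_rel_coarse_seqs[OF st] by auto
  obtain E where E: "E \<in> ctrl P" "joinable mem \<N> (num mem 0) (rel_code E) (ctrl_code P) (base P)
    (seq_code s) (seq_code t) (code mem (pts P))"
    using joinable_std[OF P st] by (elim bexE)
  have join: "joinable smem (star \<N>) (star (num mem 0)) (star (rel_code E)) (star (ctrl_code P))
    (star (base P)) (star (seq_code s)) (star (seq_code t)) (star (code mem (pts P)))"
    using elementary[of FJoin "(\<lambda>_. \<N>)(1 := num mem 0, 2 := rel_code E, 3 := ctrl_code P,
      4 := base P, 5 := seq_code s, 6 := seq_code t, 7 := code mem (pts P))"] E(2)
    by (simp add: std.sat_FJoin nst.sat_FJoin)
  obtain D where D: "smem D (star (ctrl_code P))"
    "\<forall>E\<in>ctrl P. star_rel mem smem star E \<subseteq> rel_of smem D"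
    using controlled_upper_bound[OF P] by (elim exE conjE)
  have ij: "i \<in> hN" "j \<in> hN" using i j by (auto simp: infinite_hypernats_iff)
  obtain k w where w: "smem k (star \<N>)" "path smem (star (num mem 0)) k w ?x ?y"
    "\<forall>h a. (h, a) \<in> rel_of smem w \<longrightarrow> smem a (star (code mem (pts P))) \<and>
         ((\<exists>l. smem l (star \<N>) \<and> \<not> smem l i \<and> (l, a) \<in> rel_of smem (star (seq_code s))) \<or>
          (\<exists>l. smem l (star \<N>) \<and> \<not> smem l j \<and> (l, a) \<in> rel_of smem (star (seq_code t))) \<or>
          (a, star (base P)) \<notin> rel_of smem D)"
    "\<forall>a b. (a, b) \<in> steps smem k w \<longrightarrow> (a, b) \<in> rel_of smem (star (rel_code E))"
    using join[unfolded joinable_def, THEN spec, THEN spec, THEN spec, THEN spec, THEN spec,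
        of D i j ?x ?y, THEN mp] D(1) ij star_seq_rel[OF P s ij(1)] star_seq_rel[OF P t ij(2)]
    unfolding hypernats_iff by blast
  show ?thesis
  proof (rule iota_relI[OF _ w(2)])
    show "k \<in> hN" using w(1) by (simp add: hypernats_iff)
    show "finitely_close mem smem star P a b" if "(a, b) \<in> steps smem k w" for a b
      unfolding finitely_close_def star_rel_eq
      by (rule bexI[OF _ E(1)]) (use w(4) that in blast)
    show "a \<in> inf_pts P" if "(h, a) \<in> rel_of smem w" for h a
    proof -
      have a: "smem a (star (code mem (pts P)))"
        and "(\<exists>l. smem l (star \<N>) \<and> \<not> smem l i \<and> (l, a) \<in> rel_of smem (star (seq_code s))) \<or>
          (\<exists>l. smem l (star \<N>) \<and> \<not> smem l j \<and> (l, a) \<in> rel_of smem (star (seq_code t))) \<or>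
          (a, star (base P)) \<notin> rel_of smem D"
        using w(3) that by simp_all
      then consider (s) l where "l \<in> hN" "\<not> smem l i" "(l, a) \<in> rel_of smem (star (seq_code s))"
        | (t) l where "l \<in> hN" "\<not> smem l j" "(l, a) \<in> rel_of smem (star (seq_code t))"
        | (D) "(a, star (base P)) \<notin> rel_of smem D"
        unfolding hypernats_iff by blast
      then show ?thesis
      proof cases
        case s
        then show ?thesis
          using star_seq_in_INF[OF P \<open>s \<in> coarse_seqs P\<close> infinite_hypernats_upward[OF i]] by blast
      next
        case t
        then show ?thesis
          using star_seq_in_INF[OF P \<open>t \<in> coarse_seqs P\<close> infinite_hypernats_upward[OF j]] by blast
      next
        case D
        then show ?thesis
          using a \<open>\<forall>E\<in>ctrl P. star_rel mem smem star E \<subseteq> rel_of smem D\<close>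
          by (auto simp: INF_pts_def star_set_def elts_def finitely_close_def)
      qed
    qed
  qed
qed

lemma iota_class_eq:
  assumes "P \<in> CC" "(s, t) \<in> epsilon_rel P"
    "i \<in> infinite_hypernats mem smem star" "j \<in> infinite_hypernats mem smem star"
  shows "iota_rel mem smem star P `` {star_seq mem smem star s i} =
    iota_rel mem smem star P `` {star_seq mem smem star t j}"
  \<comment> \<open>The two inclusions use transitivity with chains in both directions; the reverse
    chain comes from exchanging \<open>s\<close> and \<open>t\<close>.\<close>
  using iota_rel_star_seq[OF assms] iota_rel_star_seq[OF assms(1) epsilon_rel_sym[OF assms(2)] assms(4,3)]
  by (auto intro: iota_rel_trans)

text \<open>Stated for any \<open>c\<close> inside the epsilon class of \<open>s\<close>, so that it
  evaluates \<open>omega\<close> on sigma classes as well as \<open>omega'\<close> on epsilon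
  classes.\<close>

lemma the_iota_class:
  assumes P: "P \<in> CC" and c: "s \<in> c" "\<And>t. t \<in> c \<Longrightarrow> (s, t) \<in> epsilon_rel P"
    and i: "i \<in> infinite_hypernats mem smem star"
  shows "(THE q. \<exists>t\<in>c. \<exists>j\<in>infinite_hypernats mem smem star.
      q = iota_rel mem smem star P `` {star_seq mem smem star t j}) =
    iota_rel mem smem star P `` {star_seq mem smem star s i}"
proof (rule the_equality)
  show "\<exists>t\<in>c. \<exists>j\<in>infinite_hypernats mem smem star. iota_rel mem smem star P `` {star_seq mem smem star s i}
      = iota_rel mem smem star P `` {star_seq mem smem star t j}"
    using c(1) i by blast
next
  fix q assume "\<exists>t\<in>c. \<exists>j\<in>infinite_hypernats mem smem star.
      q = iota_rel mem smem star P `` {star_seq mem smem star t j}"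
  then obtain t j where "t \<in> c" "j \<in> infinite_hypernats mem smem star"
      "q = iota_rel mem smem star P `` {star_seq mem smem star t j}"
    by blast
  with iota_class_eq[OF P c(2) i] show "q = iota_rel mem smem star P `` {star_seq mem smem star s i}"
    by metis
qed

lemma omega_class:
  assumes P: "P \<in> CC" and s: "s \<in> coarse_seqs P" and i: "i \<in> infinite_hypernats mem smem star"
  shows "omega mem smem star P (sigma_rel P `` {s}) =
      iota_rel mem smem star P `` {star_seq mem smem star s i}"
proof -
  have "t \<in> sigma_rel P `` {s} \<Longrightarrow> (s, t) \<in> epsilon_rel P" for t
    using sigma_rel_subset_epsilon_rel[OF spaces[OF P]] by blast
  from the_iota_class[OF P _ this i, of "sigma_rel P `` {s}"] show ?thesis
    using s sigma_rel_refl[OF s] by (simp add: omega_def sigma_def quotientI)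
qed

lemma omega'_class:
  assumes P: "P \<in> CC" and s: "s \<in> coarse_seqs P" and i: "i \<in> infinite_hypernats mem smem star"
  shows "omega' mem smem star P (epsilon_rel P `` {s}) =
      iota_rel mem smem star P `` {star_seq mem smem star s i}"
proof -
  have "t \<in> epsilon_rel P `` {s} \<Longrightarrow> (s, t) \<in> epsilon_rel P" for t
    by blast
  from the_iota_class[OF P _ this i, of "epsilon_rel P `` {s}"] show ?thesis
    using s epsilon_rel_refl[OF spaces[OF P] s] by (simp add: omega'_def epsilon_def quotientI)
qed

lemma iota_class_in_iota:
  assumes P: "P \<in> CC" and s: "s \<in> coarse_seqs P" and i: "i \<in> infinite_hypernats mem smem star"
  shows "iota_rel mem smem star P `` {star_seq mem smem star s i} \<in> iota mem smem star P"
  unfolding iota_def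
  using i by (intro quotientI star_seq_in_INF[OF P s i star_seq_rel[OF P s]])
    (simp add: infinite_hypernats_iff)

end

theorem theorem2p5:
  fixes mem :: "'u \<Rightarrow> 'u \<Rightarrow> bool"
    and smem :: "'s \<Rightarrow> 's \<Rightarrow> bool"
    and star :: "'u \<Rightarrow> 's"
    and CC :: "'u pointed_space set"
  assumes "nonstandard_setting mem CC smem star"
  shows "\<forall>P\<in>CC.
    phi P \<in> sigma P \<rightarrow> epsilon P \<and>
    omega' mem smem star P \<in> epsilon P \<rightarrow> iota mem smem star P \<and>
    omega mem smem star P \<in> sigma P \<rightarrow> iota mem smem star P \<and>
    omega mem smem star P = compose (sigma P) (omega' mem smem star P) (phi P)"
proof
  interpret nonstandard_setting mem CC smem star by (rule assms)
  fix P assume P: "P \<in> CC"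
  note space = spaces[OF P]
  obtain i where i: "i \<in> infinite_hypernats mem smem star"
    using infinite_hypernats_nonempty ..
  have sigmaE: "\<exists>s\<in>coarse_seqs P. c = sigma_rel P `` {s}" if "c \<in> sigma P" for c
    using that by (auto simp: sigma_def quotient_def)
  have epsilonE: "\<exists>s\<in>coarse_seqs P. c = epsilon_rel P `` {s}" if "c \<in> epsilon P" for c
    using that by (auto simp: epsilon_def quotient_def)
  have "phi P c \<in> epsilon P" if "c \<in> sigma P" for c
    using sigmaE[OF that] phi_class[OF space] by (auto simp: epsilon_def intro: quotientI)
  moreover have "omega' mem smem star P c \<in> iota mem smem star P" if "c \<in> epsilon P" for c
    using epsilonE[OF that] omega'_class[OF P _ i] iota_class_in_iota[OF P _ i] by auto
  moreover have "omega mem smem star P c \<in> iota mem smem star P" if "c \<in> sigma P" for c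
    using sigmaE[OF that] omega_class[OF P _ i] iota_class_in_iota[OF P _ i] by auto
  moreover have "omega mem smem star P = compose (sigma P) (omega' mem smem star P) (phi P)"
  proof
    fix c
    show "omega mem smem star P c = compose (sigma P) (omega' mem smem star P) (phi P) c"
    proof (cases "c \<in> sigma P")
      case True
      then obtain s where s: "s \<in> coarse_seqs P" "c = sigma_rel P `` {s}" using sigmaE by blast
      then show ?thesis
        using True by (simp add: compose_def phi_class[OF space] omega_class[OF P _ i] omega'_class[OF P _ i])
    next
      case False
      \<comment> \<open>Off \<open>sigma P\<close> both sides are restricted functions and take the
        value \<open>undefined\<close>.\<close>
      then show ?thesis by (simp add: compose_def omega_def)
    qed
  qed
  ultimately show "phi P \<in> sigma P \<rightarrow> epsilon P \<and>
    omega' mem smem star P \<in> epsilon P \<rightarrow> iota mem smem star P \<and>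
    omega mem smem star P \<in> sigma P \<rightarrow> iota mem smem star P \<and>
    omega mem smem star P = compose (sigma P) (omega' mem smem star P) (phi P)"
    by blast
qed

end
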